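(* Let $\{\Phi_n\}_{n=1}^\infty$, $\Phi_n=\{\phi_{n,j}\}_{j=1}^{N_n}$, be a self-similar MIFS on a compact set $X\subset\mathbb{R}^d$, where $\phi_{n,j}(x)=r_{n,j}O_{n,j}(x+\alpha_{n,j})$ with $r_{n,j}\in(0,1)$, $O_{n,j}$ orthogonal matrices and $\alpha_{n,j}\in\mathbb{R}^d$. Assume that the MIFS satisfies the Moran-type open set condition (MOSC). Let $s\ge0$. If $$0<\liminf_{n\to\infty}\prod_{i=1}^n\sum_{j=1}^{N_i}r_{i,j}^s\le\limsup_{n\to\infty}\prod_{i=1}^n\sum_{j=1}^{N_i}r_{i,j}^s<+\infty$$ and $r_0:=\inf\{r_{n,j}:n\ge1,\ 1\le j\le N_n\}>0$, then: (i) All $K_k$ are uniform $s$-sets: $$+\infty>\sup\{\mathcal{H}^s(K_k):k\ge1\}\ge\inf\{\mathcal{H}^s(K_k):k\ge1\}>0.$$ (ii) $\dim_{\rm H}K_n=\underline{\dim}_{\rm B}K_n=\overline{\dim}_{\rm B}K_n=s$ for all $n\ge1$.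
   Context: Self-similar MIFS. $X\subset\mathbb{R}^d$ is a nonempty compact set; for each $n\ge1$, $\Phi_n=\{\phi_{n,j}\}_{j=1}^{N_n}$ with $2\le N_n<+\infty$ consists of contracting similarities $\phi_{n,j}(x)=r_{n,j}O_{n,j}(x+\alpha_{n,j})$ with $\phi_{n,j}(X)\subseteq X$; and there are constants $0<c_{1,n}\le c_{2,n}<1$ with $c_{1,n}\le r_{n,j}\le c_{2,n}$ for all $1\le j\le N_n$ and $\lim_{n\to\infty}\prod_{j=1}^n c_{2,j}=0$. The metric is the Euclidean one. Attractors. For each $n\ge1$, $K_n=\{\lim_{k\to\infty}\phi_{n,j_n}\circ\cdots\circ\phi_{n+k,j_{n+k}}(a): 1\le j_{n+k}\le N_{n+k},\ k\ge0\}$, a compact set independent of $a\in X$; $\{K_n\}$ is the unique sequence of nonempty compact subsets of $X$ with $K_n=\bigcup_{j=1}^{N_n}\phi_{n,j}(K_{n+1})$ for all $n\ge1$. MOSC. There is a sequence of open sets $V_n\subset X$ such that for all $n\ge1$: $\phi_{n,j}(V_{n+1})\subseteq V_n$ for $1\le j\le N_n$, and $\phi_{n,i}(V_{n+1})\cap\phi_{n,j}(V_{n+1})=\emptyset$ for $1\le i\ne j\le N_n$; and moreover $\inf_{n\ge1}\mathcal{L}^d(V_n)>0$, where $\mathcal{L}^d$ is $d$-dimensional Lebesgue measure. $\mathcal{H}^s$ is $s$-dimensional Hausdorff measure; $\dim_{\rm H}$, $\underline{\dim}_{\rm B}$, $\overline{\dim}_{\rm B}$ are Hausdorff, lower box and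 upper box dimension. *)

theory Defs
  imports "HOL-Analysis.Analysis"
begin

(* |U|^s with the usual conventions: the empty set contributes 0, and |U|^0 = 1 for every
   nonempty U.  The case s = 0 is separate because 0 powr 0 = 0. *)
definition diam_power :: "real \<Rightarrow> 'a::metric_space set \<Rightarrow> ennreal" where
  "diam_power s U =
     (if U = {} then 0 else if s = 0 then 1 else ennreal (diameter U powr s))"

(* Countable covers by arbitrary sets of diameter at most \<delta>.  Finite covers are included,
   since U i may be empty.  Boundedness is explicit because diameter is real-valued and
   carries no information on unbounded sets. *)
definition hausdorff_premeasure :: "real \<Rightarrow> real \<Rightarrow> 'a::metric_space set \<Rightarrow> ennreal" where
  "hausdorff_premeasure \<delta> s E =
     (INF U \<in> {U :: nat \<Rightarrow> 'a set. E \<subseteq> (\<Union>i. U i) \<and> (\<forall>i. bounded (U i) \<and> diameter (U i) \<le> \<delta>)}.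
        \<Sum>i. diam_power s (U i))"

(* The premeasure is antitone in \<delta>, so its limit as \<delta> tends to 0 is a supremum. *)
definition hausdorff_measure :: "real \<Rightarrow> 'a::metric_space set \<Rightarrow> ennreal" where
  "hausdorff_measure s E = (SUP \<delta> \<in> {0<..}. hausdorff_premeasure \<delta> s E)"

definition hausdorff_dim :: "'a::metric_space set \<Rightarrow> ereal" where
  "hausdorff_dim E = (INF s \<in> {s. 0 \<le> s \<and> hausdorff_measure s E = 0}. ereal s)"

(* Smallest number of sets of diameter at most \<delta> that cover E; meaningful for totally bounded E
   (in Euclidean space: bounded E), the sets for which box dimensions are defined. *)
definition covering_number :: "real \<Rightarrow> 'a::metric_space set \<Rightarrow> nat" where
  "covering_number \<delta> E =
     (LEAST m. \<exists>C. finite C \<and> card C = m \<and> E \<subseteq> \<Union>C \<and>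
                   (\<forall>U\<in>C. bounded U \<and> diameter U \<le> \<delta>))"

definition lower_box_dim :: "'a::metric_space set \<Rightarrow> ereal" where
  "lower_box_dim E =
     Liminf (at_right 0) (\<lambda>\<delta>. ereal (ln (real (covering_number \<delta> E)) / (- ln \<delta>)))"

definition upper_box_dim :: "'a::metric_space set \<Rightarrow> ereal" where
  "upper_box_dim E =
     Limsup (at_right 0) (\<lambda>\<delta>. ereal (ln (real (covering_number \<delta> E)) / (- ln \<delta>)))"

(* A system is given by the data N, r, Q, \<alpha>.  Only the indices n \<ge> 1 and 1 \<le> j \<le> N n
   matter; values at other indices are irrelevant. *)

definition mifs_map ::
  "(nat \<Rightarrow> nat \<Rightarrow> real) \<Rightarrow> (nat \<Rightarrow> nat \<Rightarrow> real^'d^'d) \<Rightarrow> (nat \<Rightarrow> nat \<Rightarrow> real^'d) \<Rightarrow>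
   nat \<Rightarrow> nat \<Rightarrow> real^'d \<Rightarrow> real^'d" where
  "mifs_map r Q \<alpha> n j x = r n j *\<^sub>R (Q n j *v (x + \<alpha> n j))"

definition self_similar_mifs ::
  "(real^'d) set \<Rightarrow> (nat \<Rightarrow> nat) \<Rightarrow> (nat \<Rightarrow> nat \<Rightarrow> real) \<Rightarrow> (nat \<Rightarrow> nat \<Rightarrow> real^'d^'d) \<Rightarrow>
   (nat \<Rightarrow> nat \<Rightarrow> real^'d) \<Rightarrow> bool" where
  "self_similar_mifs X N r Q \<alpha> \<longleftrightarrow>
     compact X \<and> X \<noteq> {} \<and>
     (\<forall>n\<ge>1. 2 \<le> N n) \<and>
     (\<forall>n\<ge>1. \<forall>j\<in>{1..N n}. 0 < r n j \<and> r n j < 1 \<and> orthogonal_matrix (Q n j) \<and>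
        mifs_map r Q \<alpha> n j ` X \<subseteq> X) \<and>
     (\<exists>c\<^sub>1 c\<^sub>2 :: nat \<Rightarrow> real.
        (\<forall>n\<ge>1. 0 < c\<^sub>1 n \<and> c\<^sub>1 n \<le> c\<^sub>2 n \<and> c\<^sub>2 n < 1 \<and>
           (\<forall>j\<in>{1..N n}. c\<^sub>1 n \<le> r n j \<and> r n j \<le> c\<^sub>2 n)) \<and>
        (\<lambda>n. \<Prod>j=1..n. c\<^sub>2 j) \<longlonglongrightarrow> 0)"

(* \<phi> n (\<omega> n) \<circ> ... \<circ> \<phi> (n+k) (\<omega> (n+k)) *)
primrec mifs_comp ::
  "(nat \<Rightarrow> nat \<Rightarrow> 'a \<Rightarrow> 'a) \<Rightarrow> (nat \<Rightarrow> nat) \<Rightarrow> nat \<Rightarrow> nat \<Rightarrow> 'a \<Rightarrow> 'a" where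
  "mifs_comp \<phi> \<omega> n 0 = \<phi> n (\<omega> n)"
| "mifs_comp \<phi> \<omega> n (Suc k) = mifs_comp \<phi> \<omega> n k \<circ> \<phi> (n + Suc k) (\<omega> (n + Suc k))"

(* The base point a is a parameter; for a in X the set does not depend on it. *)
definition mifs_attractor ::
  "(nat \<Rightarrow> nat) \<Rightarrow> (nat \<Rightarrow> nat \<Rightarrow> 'a::topological_space \<Rightarrow> 'a) \<Rightarrow> 'a \<Rightarrow> nat \<Rightarrow> 'a set" where
  "mifs_attractor N \<phi> a n =
     {x. \<exists>\<omega>. (\<forall>k. \<omega> (n + k) \<in> {1..N (n + k)}) \<and> (\<lambda>k. mifs_comp \<phi> \<omega> n k a) \<longlonglongrightarrow> x}"

definition moran_open_set_condition ::
  "(real^'d) set \<Rightarrow> (nat \<Rightarrow> nat) \<Rightarrow> (nat \<Rightarrow> nat \<Rightarrow> real^'d \<Rightarrow> real^'d) \<Rightarrow> bool" where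
  "moran_open_set_condition X N \<phi> \<longleftrightarrow>
     (\<exists>V :: nat \<Rightarrow> (real^'d) set.
        (\<forall>n\<ge>1. open (V n) \<and> V n \<subseteq> X) \<and>
        (\<forall>n\<ge>1. \<forall>j\<in>{1..N n}. \<phi> n j ` V (Suc n) \<subseteq> V n) \<and>
        (\<forall>n\<ge>1. \<forall>i\<in>{1..N n}. \<forall>j\<in>{1..N n}. i \<noteq> j \<longrightarrow>
           \<phi> n i ` V (Suc n) \<inter> \<phi> n j ` V (Suc n) = {}) \<and>
        0 < (INF n\<in>{1..}. emeasure lebesgue (V n)))"

end

theory Submission
  imports Defs
begin

text \<open>No measure is constructed.  Write \<open>H n\<close> for the product of the first \<open>n - 1\<close> sums, which is
  bounded above and below; the words of length \<open>m\<close> starting at level \<open>n\<close> carry the total weight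
  \<open>H (n + m) / H n\<close>.  Covering by cylinders gives the upper bounds.  For the lower bounds, a ball
  of radius \<open>\<rho>\<close> meets long cylinders of total weight at most a constant times \<open>\<rho>\<close> to the power
  \<open>s\<close>: inductively the bound is \<open>\<rho>\<close> to the power \<open>s - d\<close> times the volume of the part of the Moran
  open set near the ball, and these volumes add up because the images of the open sets are
  disjoint.  By compactness, finitely many balls cover the attractor, so their weights sum to at
  least the total weight.\<close>

section \<open>Hausdorff measure and box counting\<close>

text \<open>The obstacle is that words of one length have ratios of very different sizes, so no
  single length matches a given radius. Recursion on the first letter avoids handling stopping
  words: passing from level n to level n + 1 divides the radius by the ratio of the letter, and each
  branch stops by itself once its radius is comparable with the size of X. Ratios are at least
  \<open>r\<^sub>0\<close>, so the radius at which a branch stops overshoots by at most the factor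
  \<open>1 / r\<^sub>0\<close>; this is the source of side conditions such as
  \<open>\<rho> \<le> 1 / r\<^sub>0\<close>, under which the stopped case costs only a constant. The
  condition on the product of the \<open>c (n + i)\<close> guarantees that m letters are enough to
  stop. Every step changes the level, so all statements run over all n. The bounds for the measures
  involve only the bounds of H, the exponent, the dimension, the diameter of X,
  \<open>r\<^sub>0\<close> and the least volume of the open sets, none of which depends on the
  level; this gives uniformity over all attractors.\<close>

lemma hausdorff_premeasure_le:
  assumes "E \<subseteq> (\<Union>i. U i)" "\<And>i. bounded (U i)" "\<And>i. diameter (U i) \<le> \<delta>"
  shows "hausdorff_premeasure \<delta> s E \<le> (\<Sum>i. diam_power s (U i))"
  unfolding hausdorff_premeasure_def by (rule INF_lower) (use assms in auto)

lemma hausdorff_premeasure_greatest: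
  assumes "\<And>U. \<lbrakk>E \<subseteq> (\<Union>i. U i); \<And>i. bounded (U i); \<And>i. diameter (U i) \<le> \<delta>\<rbrakk>
             \<Longrightarrow> z \<le> (\<Sum>i. diam_power s (U i))"
  shows "z \<le> hausdorff_premeasure \<delta> s E"
  unfolding hausdorff_premeasure_def by (rule INF_greatest) (use assms in auto)

lemma hausdorff_premeasure_antimono:
  assumes "\<delta> \<le> \<epsilon>"
  shows "hausdorff_premeasure \<epsilon> s E \<le> hausdorff_premeasure \<delta> s E"
  by (rule hausdorff_premeasure_greatest, rule hausdorff_premeasure_le)
    (use assms order_trans in blast)+

lemma hausdorff_premeasure_le_measure:
  "0 < \<delta> \<Longrightarrow> hausdorff_premeasure \<delta> s E \<le> hausdorff_measure s E"
  unfolding hausdorff_measure_def by (rule SUP_upper) simp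

lemma hausdorff_measure_least:
  assumes "0 < \<epsilon>" "\<And>\<delta>. \<lbrakk>0 < \<delta>; \<delta> \<le> \<epsilon>\<rbrakk> \<Longrightarrow> hausdorff_premeasure \<delta> s E \<le> z"
  shows "hausdorff_measure s E \<le> z"
  unfolding hausdorff_measure_def
proof (rule SUP_least)
  fix \<delta> :: real assume "\<delta> \<in> {0<..}"
  then have "hausdorff_premeasure (min \<delta> \<epsilon>) s E \<le> z" using assms by auto
  then show "hausdorff_premeasure \<delta> s E \<le> z"
    using hausdorff_premeasure_antimono[of "min \<delta> \<epsilon>" \<delta>] by (meson min.cobounded1 order_trans)
qed

section \<open>Dependence of the measure on the exponent, and Hausdorff dimension\<close>

lemma diam_power_pos: "0 < s \<Longrightarrow> diam_power s U = ennreal (diameter U powr s)"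
  by (simp add: diam_power_def)

lemma diam_power_le:
  assumes "0 \<le> s" "s < t" "0 < \<delta>" "bounded U" "diameter U \<le> \<delta>"
  shows "diam_power t U \<le> ennreal (\<delta> powr (t - s)) * diam_power s U"
proof (cases "U = {}")
  case False
  have d: "0 \<le> diameter U" using assms(4) by (rule diameter_ge_0)
  have "diameter U powr t = diameter U powr (t - s) * diameter U powr s"
    by (simp flip: powr_add)
  also have "\<dots> \<le> \<delta> powr (t - s) * diameter U powr s"
    using assms d by (intro mult_right_mono powr_mono2) auto
  finally have "ennreal (diameter U powr t) \<le> ennreal (\<delta> powr (t - s)) * ennreal (diameter U powr s)"
    by (simp add: ennreal_mult' [symmetric] ennreal_leI)
  \<comment> \<open>This bound serves s = 0, where a nonempty set has \<open>diam_power\<close> 1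
    although \<open>diameter U powr 0\<close> is 0 for a singleton.\<close>
  moreover have "ennreal (diameter U powr t) \<le> ennreal (\<delta> powr t)"
    using assms d by (intro ennreal_leI powr_mono2) auto
  ultimately show ?thesis using assms False by (auto simp: diam_power_def)
qed (simp add: diam_power_def)

lemma suminf_diam_power_le:
  assumes "0 \<le> s" "s < t" "0 < \<delta>" "\<And>i. bounded (U i)" "\<And>i. diameter (U i) \<le> \<delta>"
  shows "(\<Sum>i. diam_power t (U i)) \<le> ennreal (\<delta> powr (t - s)) * (\<Sum>i. diam_power s (U i))"
  by (subst ennreal_suminf_cmult [symmetric], rule suminf_le) (auto intro!: diam_power_le assms)

lemma hausdorff_measure_antimono_exponent:
  assumes "0 \<le> s" "s < t"
  shows "hausdorff_measure t E \<le> hausdorff_measure s E"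
proof (rule hausdorff_measure_least[of 1])
  fix \<delta> :: real assume \<delta>: "0 < \<delta>" "\<delta> \<le> 1"
  have "hausdorff_premeasure \<delta> t E \<le> hausdorff_premeasure \<delta> s E"
  proof (rule hausdorff_premeasure_greatest)
    fix U assume U: "E \<subseteq> (\<Union>i::nat. U i)" "\<And>i. bounded (U i)" "\<And>i. diameter (U i) \<le> \<delta>"
    have "hausdorff_premeasure \<delta> t E \<le> (\<Sum>i. diam_power t (U i))"
      using U by (rule hausdorff_premeasure_le)
    also have "\<dots> \<le> ennreal (1 powr (t - s)) * (\<Sum>i. diam_power s (U i))"
      using assms U order_trans[OF U(3) \<delta>(2)] by (intro suminf_diam_power_le) simp_all
    finally show "hausdorff_premeasure \<delta> t E \<le> (\<Sum>i. diam_power s (U i))" by simp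
  qed
  also have "\<dots> \<le> hausdorff_measure s E" using \<delta> by (intro hausdorff_premeasure_le_measure)
  finally show "hausdorff_premeasure \<delta> t E \<le> hausdorff_measure s E" .
qed simp

text \<open>A number h above the s-measure admits, at every scale \<delta>, a cover whose s-sum is
  below h; its t-sum is then at most h times a power of \<delta> with positive exponent.\<close>

lemma hausdorff_measure_eq_0:
  assumes "0 \<le> s" "s < t" "hausdorff_measure s E < \<infinity>"
  shows "hausdorff_measure t E = 0"
proof -
  obtain g where "0 \<le> g" "hausdorff_measure s E = ennreal g"
    using assms(3) by (auto simp: less_top_ennreal)
  then have "hausdorff_measure s E < ennreal (g + 1)" by (simp add: ennreal_lessI)
  with \<open>0 \<le> g\<close> obtain h where h: "hausdorff_measure s E < ennreal h" "0 \<le> h"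
    by (meson add_nonneg_nonneg zero_le_one)
  have bound: "hausdorff_premeasure \<delta> t E \<le> ennreal (\<delta> powr (t - s) * h)" if "0 < \<delta>" for \<delta>
  proof -
    have "hausdorff_premeasure \<delta> s E < ennreal h"
      using hausdorff_premeasure_le_measure[OF that] h(1) by (rule le_less_trans)
    then obtain U where U: "E \<subseteq> (\<Union>i::nat. U i)" "\<And>i. bounded (U i)" "\<And>i. diameter (U i) \<le> \<delta>"
        and lt: "(\<Sum>i. diam_power s (U i)) < ennreal h"
      unfolding hausdorff_premeasure_def INF_less_iff by blast
    have "hausdorff_premeasure \<delta> t E \<le> (\<Sum>i. diam_power t (U i))"
      using U by (rule hausdorff_premeasure_le)
    also have "\<dots> \<le> ennreal (\<delta> powr (t - s)) * (\<Sum>i. diam_power s (U i))"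
      using assms that U by (intro suminf_diam_power_le)
    also have "\<dots> \<le> ennreal (\<delta> powr (t - s)) * ennreal h"
      using lt by (intro mult_left_mono) auto
    finally show ?thesis by (simp add: ennreal_mult' [symmetric])
  qed
  have lim: "((\<lambda>\<delta>. ennreal (\<delta> powr (t - s) * h)) \<longlongrightarrow> ennreal 0) (at_right 0)"
  proof (intro tendsto_ennrealI tendsto_mult_left_zero)
    show "((\<lambda>\<delta>. \<delta> powr (t - s)) \<longlongrightarrow> 0) (at_right (0::real))"
      using assms by (intro tendsto_eq_intros tendsto_powr') 
        (auto simp: eventually_at_right_less less_imp_le intro: eventually_mono[OF eventually_at_right_less])
  qed
  \<comment> \<open>The premeasure at a fixed \<epsilon> lies below the bound for every smaller
    \<delta>, hence below the limit of these bounds.\<close>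
  have "hausdorff_premeasure \<epsilon> t E \<le> 0" if "0 < \<epsilon>" for \<epsilon>
  proof -
    have "\<forall>\<^sub>F \<delta> in at_right 0. 0 < \<delta> \<and> \<delta> < \<epsilon>"
      using that by (auto simp: eventually_at_right_field)
    then have "\<forall>\<^sub>F \<delta> in at_right 0. hausdorff_premeasure \<epsilon> t E \<le> ennreal (\<delta> powr (t - s) * h)"
      by (rule eventually_mono) (meson bound hausdorff_premeasure_antimono less_imp_le order_trans)
    then show ?thesis using tendsto_lowerbound[OF lim] by simp
  qed
  then show ?thesis unfolding hausdorff_measure_def by (simp add: SUP_eq_iff)
qed

text \<open>The measure vanishes above s because it is finite at s, and stays positive up to s by
  monotonicity; the exponents of measure zero thus form exactly the open ray beyond s.\<close>

lemma hausdorff_dim_eqI: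
  assumes "0 \<le> s" "0 < hausdorff_measure s E" "hausdorff_measure s E < \<infinity>"
  shows "hausdorff_dim E = ereal s"
proof -
  have "hausdorff_measure t E = 0 \<longleftrightarrow> s < t" if "0 \<le> t" for t
  proof (cases "s < t")
    case False
    then have "hausdorff_measure s E \<le> hausdorff_measure t E"
      using hausdorff_measure_antimono_exponent[OF that, of s] by (cases "s = t") auto
    then show ?thesis using assms(2) False by auto
  qed (use hausdorff_measure_eq_0[OF assms(1) _ assms(3)] in simp)
  then have "{t. 0 \<le> t \<and> hausdorff_measure t E = 0} = {s<..}"
    using assms(1) by auto
  moreover have "(INF t\<in>{s<..}. ereal t) = ereal s"
  proof (rule antisym)
    show "(INF t\<in>{s<..}. ereal t) \<le> ereal s"
    proof (rule ereal_le_epsilon2)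
      fix e :: real assume "0 < e"
      then show "(INF t\<in>{s<..}. ereal t) \<le> ereal s + ereal e"
        by (intro INF_lower2[of "s + e"]) auto
    qed
  qed (auto intro: INF_greatest)
  ultimately show ?thesis unfolding hausdorff_dim_def by simp
qed

section \<open>Covering numbers and box dimensions\<close>

lemma covering_number_le:
  assumes "finite C" "E \<subseteq> \<Union>C" "\<And>U. U \<in> C \<Longrightarrow> bounded U" "\<And>U. U \<in> C \<Longrightarrow> diameter U \<le> \<delta>"
  shows "covering_number \<delta> E \<le> card C"
  unfolding covering_number_def by (rule Least_le) (use assms in blast)

text \<open>Some finite cover \<open>C\<close> has to be supplied, because \<open>LEAST\<close> says
  nothing about a predicate that is never satisfied.\<close>

lemma covering_numberE:
  assumes "finite C" "E \<subseteq> \<Union>C" "\<And>U. U \<in> C \<Longrightarrow> bounded U" "\<And>U. U \<in> C \<Longrightarrow> diameter U \<le> \<delta>"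
  obtains D where "finite D" "card D = covering_number \<delta> E" "E \<subseteq> \<Union>D"
    "\<And>U. U \<in> D \<Longrightarrow> bounded U" "\<And>U. U \<in> D \<Longrightarrow> diameter U \<le> \<delta>"
  using LeastI[of "\<lambda>m. \<exists>C. finite C \<and> card C = m \<and> E \<subseteq> \<Union>C \<and>
                   (\<forall>U\<in>C. bounded U \<and> diameter U \<le> \<delta>)" "card C"] assms
  unfolding covering_number_def by blast

text \<open>A list counts repeated pieces with multiplicity, as is convenient when different words
  have the same image. It is continued by empty sets, which contribute 0; their diameter 0 is
  admissible by \<open>0 \<le> \<delta>\<close>.\<close>

lemma hausdorff_premeasure_le_sum_list:
  assumes "E \<subseteq> \<Union>(set Us)" "\<And>U. U \<in> set Us \<Longrightarrow> bounded U" "\<And>U. U \<in> set Us \<Longrightarrow> diameter U \<le> \<delta>"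
    and "0 \<le> \<delta>"
  shows "hausdorff_premeasure \<delta> s E \<le> (\<Sum>U\<leftarrow>Us. diam_power s U)"
proof -
  define V where "V i = (if i < length Us then Us ! i else {})" for i
  have "hausdorff_premeasure \<delta> s E \<le> (\<Sum>i. diam_power s (V i))"
  proof (rule hausdorff_premeasure_le)
    have "\<Union>(set Us) \<subseteq> (\<Union>i. V i)"
    proof
      fix x assume "x \<in> \<Union>(set Us)"
      then obtain i where "i < length Us" "x \<in> Us ! i" by (auto simp: in_set_conv_nth)
      then show "x \<in> (\<Union>i. V i)" by (auto simp: V_def intro!: exI[of _ i])
    qed
    with assms(1) show "E \<subseteq> (\<Union>i. V i)" by (rule order_trans)
  qed (use assms in \<open>simp_all add: V_def\<close>)
  also have "\<dots> = (\<Sum>i<length Us. diam_power s (V i))"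
    by (rule suminf_finite) (auto simp: V_def diam_power_def)
  also have "\<dots> = (\<Sum>U\<leftarrow>Us. diam_power s U)"
    by (simp add: V_def sum_list_sum_nth atLeast0LessThan)
  finally show ?thesis .
qed

text \<open>Each piece of a smallest cover contributes at most \<open>\<delta> powr s\<close>. What
  is needed is therefore a lower bound for the premeasure at the scale \<delta> itself, not only for
  the measure.\<close>

lemma covering_number_ge:
  assumes "0 < s" "0 < \<delta>"
    and "ennreal b \<le> hausdorff_premeasure \<delta> s E"
    and "finite C" "E \<subseteq> \<Union>C" "\<And>U. U \<in> C \<Longrightarrow> bounded U" "\<And>U. U \<in> C \<Longrightarrow> diameter U \<le> \<delta>"
  shows "b * \<delta> powr - s \<le> real (covering_number \<delta> E)"
proof -
  obtain D where D: "finite D" "card D = covering_number \<delta> E" "E \<subseteq> \<Union>D"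
    "\<And>U. U \<in> D \<Longrightarrow> bounded U" "\<And>U. U \<in> D \<Longrightarrow> diameter U \<le> \<delta>"
    using covering_numberE[OF assms(4-7)] by blast
  obtain Us where Us: "set Us = D" "distinct Us" using finite_distinct_list[OF D(1)] by blast
  have "ennreal b \<le> (\<Sum>U\<leftarrow>Us. diam_power s U)"
    using assms(2) D Us by (intro order_trans[OF assms(3)] hausdorff_premeasure_le_sum_list) auto
  also have "\<dots> = (\<Sum>U\<in>D. diam_power s U)" using Us by (simp add: sum_list_distinct_conv_sum_set)
  also have "\<dots> \<le> (\<Sum>U\<in>D. ennreal (\<delta> powr s))"
    using assms D by (intro sum_mono) (auto simp: diam_power_pos intro!: ennreal_leI powr_mono2 diameter_ge_0)
  also have "\<dots> = ennreal (real (covering_number \<delta> E) * \<delta> powr s)"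
    using D by (simp add: ennreal_mult ennreal_of_nat_eq_real_of_nat)
  finally have "b \<le> real (covering_number \<delta> E) * \<delta> powr s" by simp
  then show ?thesis using assms(2) by (simp add: powr_minus divide_simps)
qed

lemma box_dim_eqI:
  assumes "0 < b" "0 < c"
    and "\<forall>\<^sub>F \<delta> in at_right 0. b * \<delta> powr - s \<le> real (covering_number \<delta> E)"
    and "\<forall>\<^sub>F \<delta> in at_right 0. real (covering_number \<delta> E) \<le> c * \<delta> powr - s"
  shows "lower_box_dim E = ereal s" "upper_box_dim E = ereal s"
proof -
  have at_top: "filterlim (\<lambda>\<delta>::real. - ln \<delta>) at_top (at_right 0)"
    using ln_at_0 by (simp add: filterlim_uminus_at_bot)
  have lim: "((\<lambda>\<delta>. s + ln k / - ln \<delta>) \<longlongrightarrow> s) (at_right 0)" for k :: real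
    using tendsto_add[OF tendsto_const
      tendsto_divide_0[OF tendsto_const filterlim_at_top_imp_at_infinity[OF at_top]]] by simp
  have ln_eq: "ln (k * \<delta> powr - s) / - ln \<delta> = s + ln k / - ln \<delta>" if "0 < k" "0 < \<delta>" "\<delta> < 1" for k \<delta> :: real
    using that by (simp add: ln_mult ln_powr divide_simps)
  have small: "\<forall>\<^sub>F \<delta> in at_right 0. 0 < \<delta> \<and> \<delta> < (1::real)"
    by (auto simp: eventually_at_right_field intro: exI[of _ 1])
  have "((\<lambda>\<delta>. ln (real (covering_number \<delta> E)) / - ln \<delta>) \<longlongrightarrow> s) (at_right 0)"
  proof (rule tendsto_sandwich[OF _ _ lim[of b] lim[of c]])
    show "\<forall>\<^sub>F \<delta> in at_right 0. s + ln b / - ln \<delta> \<le> ln (real (covering_number \<delta> E)) / - ln \<delta>"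
      using small assms(3)
    proof eventually_elim
      case (elim \<delta>)
      then have "ln (b * \<delta> powr - s) / - ln \<delta> \<le> ln (real (covering_number \<delta> E)) / - ln \<delta>"
        using assms(1) by (intro divide_right_mono ln_mono) auto
      then show ?case using elim assms(1) by (simp only: ln_eq)
    qed
    show "\<forall>\<^sub>F \<delta> in at_right 0. ln (real (covering_number \<delta> E)) / - ln \<delta> \<le> s + ln c / - ln \<delta>"
      using small assms(3,4)
    proof eventually_elim
      case (elim \<delta>)
      \<comment> \<open>The lower estimate enters here too: it makes the covering number positive,
        as monotonicity of \<open>ln\<close> requires.\<close>
      have "0 < b * \<delta> powr - s" using elim assms(1) by simp
      then have "ln (real (covering_number \<delta> E)) / - ln \<delta> \<le> ln (c * \<delta> powr - s) / - ln \<delta>"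
        using elim by (intro divide_right_mono ln_mono) auto
      then show ?case using elim assms(2) by (simp only: ln_eq)
    qed
  qed
  then have lim: "((\<lambda>\<delta>. ereal (ln (real (covering_number \<delta> E)) / - ln \<delta>)) \<longlongrightarrow> ereal s) (at_right 0)"
    by (rule tendsto_ereal)
  show "lower_box_dim E = ereal s" "upper_box_dim E = ereal s"
    unfolding lower_box_dim_def upper_box_dim_def
    by (rule lim_imp_Liminf[OF _ lim] lim_imp_Limsup[OF _ lim], simp)+
qed

section \<open>Limit sets\<close>

text \<open>A metric version without matrices; \<open>c\<close> plays the role of c_2. The products
  are required to vanish from every starting level, since all arguments pass from one level to the
  next.\<close>

locale similarity_system =
  fixes X :: "'a::heine_borel set" and N :: "nat \<Rightarrow> nat" and r :: "nat \<Rightarrow> nat \<Rightarrow> real"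
    and \<phi> :: "nat \<Rightarrow> nat \<Rightarrow> 'a \<Rightarrow> 'a" and c :: "nat \<Rightarrow> real"
  assumes compact_X: "compact X" and X_nonempty: "X \<noteq> {}"
    and N_ge: "1 \<le> n \<Longrightarrow> 1 \<le> N n"
    and r_pos: "1 \<le> n \<Longrightarrow> j \<in> {1..N n} \<Longrightarrow> 0 < r n j"
    and r_le: "1 \<le> n \<Longrightarrow> j \<in> {1..N n} \<Longrightarrow> r n j \<le> c n"
    and dist_map: "1 \<le> n \<Longrightarrow> j \<in> {1..N n} \<Longrightarrow> dist (\<phi> n j x) (\<phi> n j y) = r n j * dist x y"
    and map_X: "1 \<le> n \<Longrightarrow> j \<in> {1..N n} \<Longrightarrow> \<phi> n j ` X \<subseteq> X"
    and c_prod_lim: "1 \<le> n \<Longrightarrow> (\<lambda>m. \<Prod>i<m. c (n + i)) \<longlonglongrightarrow> 0"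
begin

lemma c_pos: "1 \<le> n \<Longrightarrow> 0 < c n"
  using r_pos[of n 1] r_le[of n 1] N_ge[of n] by auto

lemma c_prod_pos: "1 \<le> n \<Longrightarrow> 0 < (\<Prod>i<m. c (n + i))"
  by (intro prod_pos) (auto intro: c_pos)

lemma c_prod_Suc: "(\<Prod>i<Suc m. c (n + i)) = c n * (\<Prod>i<m. c (Suc n + i))"
  by (subst prod.lessThan_Suc_shift) simp

lemma inj_map: "1 \<le> n \<Longrightarrow> j \<in> {1..N n} \<Longrightarrow> inj (\<phi> n j)"
  using dist_map r_pos by (metis dist_eq_0_iff injI less_irrefl mult_eq_0_iff)

lemma continuous_map: "1 \<le> n \<Longrightarrow> j \<in> {1..N n} \<Longrightarrow> continuous_on S (\<phi> n j)"
  by (rule lipschitz_on_continuous_on[of "r n j"])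
    (simp add: lipschitz_on_def dist_map r_pos less_imp_le)

lemma diameter_map:
  assumes "1 \<le> n" "j \<in> {1..N n}" "bounded U"
  shows "bounded (\<phi> n j ` U)" "diameter (\<phi> n j ` U) \<le> r n j * diameter U"
proof -
  have r: "0 \<le> r n j" using r_pos[OF assms(1,2)] by simp
  have d: "dist x y \<le> r n j * diameter U" if "x \<in> \<phi> n j ` U" "y \<in> \<phi> n j ` U" for x y
    using that r dist_map[OF assms(1,2)] diameter_bounded_bound[OF assms(3)]
    by (auto intro!: mult_left_mono)
  then show "bounded (\<phi> n j ` U)" unfolding bounded_two_points by blast
  show "diameter (\<phi> n j ` U) \<le> r n j * diameter U"
  proof (cases "U = {}")
    case False
    have "(SUP (x, y)\<in>\<phi> n j ` U \<times> \<phi> n j ` U. dist x y) \<le> r n j * diameter U"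
    proof (rule cSUP_least)
      fix p assume "p \<in> \<phi> n j ` U \<times> \<phi> n j ` U"
      then show "(case p of (x, y) \<Rightarrow> dist x y) \<le> r n j * diameter U"
        using d by (cases p) simp
    qed (use False in simp)
    then show ?thesis using False by (simp add: diameter_def)
  qed simp
qed

text \<open>The union of the images of X under all words of length m starting at level n. Unfolding
  the outermost map makes it possible to do without words.\<close>

primrec level :: "nat \<Rightarrow> nat \<Rightarrow> 'a set" where
  "level 0 n = X"
| "level (Suc m) n = (\<Union>j\<in>{1..N n}. \<phi> n j ` level m (Suc n))"

text \<open>This is K_n without codings; \<open>mifs_attractor_eq_limit_set\<close> identifies the
  two, and all estimates are made for this form.\<close>

definition limit_set :: "nat \<Rightarrow> 'a set" where
  "limit_set n = (\<Inter>m. level m n)"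

lemma compact_level: "1 \<le> n \<Longrightarrow> compact (level m n)"
  by (induction m arbitrary: n)
    (auto intro!: compact_X compact_UN compact_continuous_image continuous_map)

lemma level_nonempty: "1 \<le> n \<Longrightarrow> level m n \<noteq> {}"
proof (induction m arbitrary: n)
  case (Suc m)
  then show ?case using N_ge[of n] by fastforce
qed (simp add: X_nonempty)

lemma level_Suc_subset: "1 \<le> n \<Longrightarrow> level (Suc m) n \<subseteq> level m n"
proof (induction m arbitrary: n)
  case 0
  then show ?case using map_X[OF 0] by fastforce
next
  case (Suc m)
  have "\<phi> n j ` level (Suc m) (Suc n) \<subseteq> \<phi> n j ` level m (Suc n)" for j
    using Suc.IH[of "Suc n"] by (intro image_mono) simp
  then show ?case unfolding level.simps(2)[of "Suc m" n] level.simps(2)[of m n] by (intro UN_mono) auto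
qed

lemma level_antimono: "1 \<le> n \<Longrightarrow> m \<le> k \<Longrightarrow> level k n \<subseteq> level m n"
  by (rule lift_Suc_antimono_le[of "\<lambda>m. level m n"]) (use level_Suc_subset in auto)

lemma compact_limit_set: "1 \<le> n \<Longrightarrow> compact (limit_set n)"
  unfolding limit_set_def by (rule compact_Inter) (auto intro: compact_level)

lemma limit_set_nonempty: "1 \<le> n \<Longrightarrow> limit_set n \<noteq> {}"
  unfolding limit_set_def
  by (rule compact_nest) (simp_all add: compact_level level_nonempty level_antimono)

lemma limit_set_subset_X: "limit_set n \<subseteq> X"
  unfolding limit_set_def using level.simps(1) by blast

lemma image_limit_set_subset:
  assumes "1 \<le> n" "j \<in> {1..N n}"
  shows "\<phi> n j ` limit_set (Suc n) \<subseteq> limit_set n"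
proof -
  have "\<phi> n j ` limit_set (Suc n) \<subseteq> level m n" for m
  proof -
    have "\<phi> n j ` limit_set (Suc n) \<subseteq> level (Suc m) n"
      using assms(2) by (auto simp: limit_set_def)
    then show ?thesis using level_Suc_subset[OF assms(1)] by blast
  qed
  then show ?thesis unfolding limit_set_def by blast
qed

text \<open>Only finitely many letters are available, so a point of every level uses one of them
  at infinitely many levels; by injectivity it does so with one and the same preimage.\<close>

lemma limit_set_subset:
  assumes n: "1 \<le> n"
  shows "limit_set n \<subseteq> (\<Union>j\<in>{1..N n}. \<phi> n j ` limit_set (Suc n))"
proof
  fix x assume "x \<in> limit_set n"
  then have "x \<in> level (Suc m) n" for m unfolding limit_set_def by blast
  then have "\<exists>j\<in>{1..N n}. x \<in> \<phi> n j ` level m (Suc n)" for m by auto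
  then obtain f where f: "\<And>m. f m \<in> {1..N n}" "\<And>m. x \<in> \<phi> n (f m) ` level m (Suc n)" by metis
  have "finite (range f)" using f(1) by (meson finite_atLeastAtMost finite_subset image_subsetI)
  then obtain k where k: "infinite {m. f m = f k}"
    using pigeonhole_infinite[of UNIV f] by auto
  obtain y where y: "x = \<phi> n (f k) y" using f(2)[of k] by blast
  have "y \<in> level m (Suc n)" for m
  proof -
    obtain i where i: "m \<le> i" "f i = f k"
      using k unfolding infinite_nat_iff_unbounded_le by blast
    have "y \<in> level i (Suc n)"
      using f(2)[of i] y inj_map[OF n f(1)[of k]] i by (auto simp: inj_eq)
    then show ?thesis using level_antimono[of "Suc n" m i] i by auto
  qed
  then show "x \<in> (\<Union>j\<in>{1..N n}. \<phi> n j ` limit_set (Suc n))"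
    using y f(1)[of k] unfolding limit_set_def by blast
qed

lemma mifs_comp_level:
  assumes "1 \<le> n" "\<And>i. \<omega> (n + i) \<in> {1..N (n + i)}" "x \<in> level m (Suc (n + k))"
  shows "mifs_comp \<phi> \<omega> n k x \<in> level (Suc (m + k)) n"
  using assms(3)
proof (induction k arbitrary: x m)
  case 0
  then show ?case using assms(2)[of 0] by auto
next
  case (Suc k)
  \<comment> \<open>\<open>mifs_comp\<close> grows at the innermost map, whereas
    \<open>level\<close> unfolds at the outermost one. As m is arbitrary in the induction, the
    innermost letter can be traded for one more level.\<close>
  have "\<phi> (n + Suc k) (\<omega> (n + Suc k)) x \<in> level (Suc m) (Suc (n + k))"
    using Suc.prems assms(2)[of "Suc k"] by auto
  from Suc.IH[OF this] show ?case by simp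
qed

lemma dist_mifs_comp:
  assumes "1 \<le> n" "\<And>i. \<omega> (n + i) \<in> {1..N (n + i)}"
  shows "dist (mifs_comp \<phi> \<omega> n k x) (mifs_comp \<phi> \<omega> n k y) \<le> (\<Prod>i<Suc k. c (n + i)) * dist x y"
proof (induction k arbitrary: x y)
  case 0
  then show ?case
    using assms(2)[of 0] dist_map[of n "\<omega> n"] r_le[of n "\<omega> n"] assms(1)
    by (auto intro!: mult_right_mono)
next
  case (Suc k)
  let ?f = "\<phi> (n + Suc k) (\<omega> (n + Suc k))"
  have "dist (mifs_comp \<phi> \<omega> n (Suc k) x) (mifs_comp \<phi> \<omega> n (Suc k) y)
      \<le> (\<Prod>i<Suc k. c (n + i)) * dist (?f x) (?f y)"
    using Suc.IH by simp
  also have "\<dots> \<le> (\<Prod>i<Suc k. c (n + i)) * (c (n + Suc k) * dist x y)"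
    using assms(2)[of "Suc k"] assms(1) c_prod_pos[OF assms(1), of "Suc k"]
      dist_map[of "n + Suc k" "\<omega> (n + Suc k)"] r_le[of "n + Suc k" "\<omega> (n + Suc k)"]
    by (intro mult_left_mono) (auto intro!: mult_right_mono)
  finally show ?case by (simp add: mult.assoc)
qed

text \<open>In one direction, the defining sequence eventually stays in each level, and levels are
  closed. In the other, pulling a point back one letter at a time yields a coding; replacing the
  pulled-back points by \<open>a\<close> changes the value by at most a vanishing product times the
  diameter of X.\<close>

lemma mifs_attractor_eq_limit_set:
  assumes n: "1 \<le> n" and a: "a \<in> X"
  shows "mifs_attractor N \<phi> a n = limit_set n"
proof (intro equalityI subsetI)
  fix x assume "x \<in> mifs_attractor N \<phi> a n"
  then obtain \<omega> where \<omega>: "\<And>k. \<omega> (n + k) \<in> {1..N (n + k)}"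
      and lim: "(\<lambda>k. mifs_comp \<phi> \<omega> n k a) \<longlonglongrightarrow> x"
    unfolding mifs_attractor_def by blast
  have "x \<in> level m n" for m
  proof (rule Lim_in_closed_set)
    show "closed (level m n)" using compact_level[OF n] by (rule compact_imp_closed)
    have "mifs_comp \<phi> \<omega> n k a \<in> level m n" if "m \<le> k" for k
      using mifs_comp_level[where m=0 and k=k, OF n \<omega>] a level_antimono[OF n, of m "Suc k"] that by auto
    then show "\<forall>\<^sub>F k in sequentially. mifs_comp \<phi> \<omega> n k a \<in> level m n"
      using eventually_ge_at_top by (rule eventually_mono[rotated])
  qed (use lim in auto)
  then show "x \<in> limit_set n" unfolding limit_set_def by blast
next
  fix x assume x: "x \<in> limit_set n"
  \<comment> \<open>The sequence \<open>f\<close> consists of the successive preimages of x; the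
    clause for \<open>k = 0\<close> fixes its start.\<close>
  have "\<exists>f. \<forall>k. (f k \<in> limit_set (n + k) \<and> (k = 0 \<longrightarrow> f k = x)) \<and>
          (\<exists>j\<in>{1..N (n + k)}. f k = \<phi> (n + k) j (f (Suc k)))"
  proof (rule dependent_nat_choice)
    fix y k assume "y \<in> limit_set (n + k) \<and> (k = 0 \<longrightarrow> y = x)"
    then have "y \<in> (\<Union>j\<in>{1..N (n + k)}. \<phi> (n + k) j ` limit_set (Suc (n + k)))"
      using subsetD[OF limit_set_subset[OF trans_le_add1[OF n]]] by blast
    then show "\<exists>z. (z \<in> limit_set (n + Suc k) \<and> (Suc k = 0 \<longrightarrow> z = x)) \<and>
        (\<exists>j\<in>{1..N (n + k)}. y = \<phi> (n + k) j z)"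
      by auto
  qed (use x in auto)
  then obtain f where f0: "f 0 = x" and f: "\<And>k. f k \<in> limit_set (n + k)"
      and "\<forall>k. \<exists>j\<in>{1..N (n + k)}. f k = \<phi> (n + k) j (f (Suc k))" by blast
  then obtain g where g: "\<And>k. g k \<in> {1..N (n + k)}" "\<And>k. f k = \<phi> (n + k) (g k) (f (Suc k))"
    by metis
  \<comment> \<open>A coding is read at the absolute levels n, n + 1, ..., while \<open>g\<close> is
    numbered from 0; the values below n do not matter.\<close>
  define \<omega> where "\<omega> i = g (i - n)" for i
  have \<omega>: "\<omega> (n + k) \<in> {1..N (n + k)}" for k using g by (simp add: \<omega>_def)
  have x_eq: "x = mifs_comp \<phi> \<omega> n k (f (Suc k))" for k
  proof (induction k)
    case 0
    then show ?case using g(2)[of 0] f0 by (simp add: \<omega>_def)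
  next
    case (Suc k)
    then show ?case using g(2)[of "Suc k"] by (simp add: \<omega>_def)
  qed
  have bound: "dist (mifs_comp \<phi> \<omega> n k a) x \<le> (\<Prod>i<Suc k. c (n + i)) * diameter X" for k
  proof -
    have "f (Suc k) \<in> X" using f limit_set_subset_X by blast
    then have "dist a (f (Suc k)) \<le> diameter X"
      using a compact_imp_bounded[OF compact_X] by (intro diameter_bounded_bound)
    then have "(\<Prod>i<Suc k. c (n + i)) * dist a (f (Suc k)) \<le> (\<Prod>i<Suc k. c (n + i)) * diameter X"
      using c_prod_pos[OF n, of "Suc k"] by (intro mult_left_mono) auto
    then show ?thesis using dist_mifs_comp[OF n \<omega>, of k a "f (Suc k)"] x_eq[of k] by simp
  qed
  have "(\<lambda>k. (\<Prod>i<Suc k. c (n + i)) * diameter X) \<longlonglongrightarrow> 0"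
    using LIMSEQ_Suc[OF c_prod_lim[OF n]] by (rule tendsto_mult_left_zero)
  then have "(\<lambda>k. mifs_comp \<phi> \<omega> n k a) \<longlonglongrightarrow> x"
    by (rule metric_tendsto_imp_tendsto[where f="\<lambda>k. (\<Prod>i<Suc k. c (n + i)) * diameter X"])
      (use bound in \<open>auto simp: dist_real_def intro!: always_eventually intro: order_trans[OF _ abs_ge_self]\<close>)
  then show "x \<in> mifs_attractor N \<phi> a n" unfolding mifs_attractor_def using \<omega> by blast
qed

end

section \<open>Volume under similarities\<close>

text \<open>Vitali's covering theorem reduces the statement to balls, whose volumes are known; the
  change of variables theorems of the library are restricted to well-ordered index types.\<close>

lemma emeasure_similarity_image_ge:
  fixes f :: "'a::euclidean_space \<Rightarrow> 'a"
  assumes k: "0 < k" and dist: "\<And>x y. dist (f x) (f y) = k * dist x y" and "surj f" and V: "open V"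
  shows "ennreal (k ^ DIM('a)) * emeasure lebesgue V \<le> emeasure lebesgue (f ` V)"
proof -
  \<comment> \<open>Surjectivity gives the inclusion of the larger ball in the image: each of its
    points must have a preimage.\<close>
  have f_ball: "f ` ball x \<rho> = ball (f x) (k * \<rho>)" for x \<rho>
  proof (intro equalityI subsetI)
    fix y assume "y \<in> ball (f x) (k * \<rho>)"
    moreover obtain z where "y = f z" using \<open>surj f\<close> by blast
    ultimately show "y \<in> f ` ball x \<rho>" using k by (auto simp: dist)
  qed (use k in \<open>auto simp: dist\<close>)
  have inj: "inj f" using k dist by (metis dist_eq_0_iff injI less_irrefl mult_eq_0_iff)
  let ?K = "{p :: 'a \<times> real. 0 < snd p \<and> ball (fst p) (snd p) \<subseteq> V}"
  let ?b = "\<lambda>p :: 'a \<times> real. ball (fst p) (snd p)"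
  have "\<exists>p. p \<in> ?K \<and> x \<in> ?b p \<and> snd p < d" if "x \<in> V" "0 < d" for x d
  proof -
    obtain e where "0 < e" "ball x e \<subseteq> V" using V \<open>x \<in> V\<close> by (rule openE)
    then show ?thesis using that(2)
      by (intro exI[of _ "(x, min e (d / 2))"]) (auto simp: subset_iff)
  qed
  then obtain C where C: "countable C" "C \<subseteq> ?K" "pairwise (\<lambda>p q. disjnt (?b p) (?b q)) C"
      and neg: "negligible (V - (\<Union>p\<in>C. ?b p))"
    by (rule Vitali_covering_theorem_balls)
  have disj: "disjoint_family_on ?b C" "disjoint_family_on (\<lambda>p. f ` ?b p) C"
    using C(3) inj by (simp_all add: disjoint_family_on_def pairwise_def disjnt_def flip: image_Int)
  have "emeasure lebesgue V \<le> emeasure lebesgue ((\<Union>p\<in>C. ?b p) \<union> (V - (\<Union>p\<in>C. ?b p)))"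
  proof (rule emeasure_mono)
    \<comment> \<open>Adding back the part of V missed by the balls gives the union of the balls
      with V, whose openness settles measurability.\<close>
    have "open ((\<Union>p\<in>C. ?b p) \<union> V)" using V by auto
    then show "(\<Union>p\<in>C. ?b p) \<union> (V - (\<Union>p\<in>C. ?b p)) \<in> sets lebesgue"
      unfolding Un_Diff_cancel by auto
  qed auto
  also have "\<dots> = emeasure lebesgue (\<Union>p\<in>C. ?b p)"
  proof (rule emeasure_Un_null_set)
    have "open (\<Union>p\<in>C. ?b p)" by auto
    then show "(\<Union>p\<in>C. ?b p) \<in> sets lebesgue" by auto
  qed (use neg in \<open>simp add: negligible_iff_null_sets\<close>)
  also have "\<dots> = (\<integral>\<^sup>+p. emeasure lebesgue (?b p) \<partial>count_space C)"
    using C(1) disj by (intro emeasure_UN_countable) auto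
  finally have "ennreal (k ^ DIM('a)) * emeasure lebesgue V
      \<le> ennreal (k ^ DIM('a)) * (\<integral>\<^sup>+p. emeasure lebesgue (?b p) \<partial>count_space C)"
    by (intro mult_left_mono) auto
  also have "\<dots> = (\<integral>\<^sup>+p. ennreal (k ^ DIM('a)) * emeasure lebesgue (?b p) \<partial>count_space C)"
    by (rule nn_integral_cmult [symmetric]) simp
  also have "\<dots> = (\<integral>\<^sup>+p. emeasure lebesgue (f ` ?b p) \<partial>count_space C)"
  proof (rule nn_integral_cong)
    fix p assume "p \<in> space (count_space C)"
    then have "0 \<le> snd p" using C(2) by auto
    then show "ennreal (k ^ DIM('a)) * emeasure lebesgue (?b p) = emeasure lebesgue (f ` ?b p)"
      using k by (simp add: f_ball emeasure_ball power_mult_distrib ennreal_mult' [symmetric] mult_ac)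
  qed
  also have "\<dots> = emeasure lebesgue (\<Union>p\<in>C. f ` ?b p)"
    using C(1) disj by (intro emeasure_UN_countable [symmetric]) (auto simp: f_ball)
  also have "\<dots> \<le> emeasure lebesgue (f ` V)"
  proof (rule emeasure_mono)
    have "open (f ` V)"
      unfolding open_contains_ball
    proof
      fix y assume "y \<in> f ` V"
      then obtain x where "x \<in> V" "y = f x" by blast
      moreover obtain e where "0 < e" "ball x e \<subseteq> V" using V \<open>x \<in> V\<close> by (rule openE)
      ultimately show "\<exists>e>0. ball y e \<subseteq> f ` V"
        using k f_ball[of x e] image_mono[of "ball x e" V f] by (intro exI[of _ "k * e"]) simp
    qed
    then show "f ` V \<in> sets lebesgue" by auto
  qed (use C in auto)
  finally show ?thesis .
qed

section \<open>Upper bounds\<close>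

lemma sum_list_concat_map:
  fixes f :: "'b \<Rightarrow> 'c::comm_monoid_add"
  shows "(\<Sum>U\<leftarrow>concat (map g xs). f U) = (\<Sum>x\<leftarrow>xs. \<Sum>U\<leftarrow>g x. f U)"
  by (induction xs) simp_all

definition moran_prod :: "(nat \<Rightarrow> nat) \<Rightarrow> (nat \<Rightarrow> nat \<Rightarrow> real) \<Rightarrow> real \<Rightarrow> nat \<Rightarrow> real" where
  "moran_prod N r s n = (\<Prod>i=1..<n. \<Sum>j=1..N i. r i j powr s)"

lemma moran_prod_Suc:
  "1 \<le> n \<Longrightarrow> moran_prod N r s (Suc n) = moran_prod N r s n * (\<Sum>j=1..N n. r n j powr s)"
  by (simp add: moran_prod_def prod.atLeastLessThan_Suc)

locale bounded_similarity_system = similarity_system X N r \<phi> c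
  for X :: "'a::heine_borel set" and N r \<phi> c +
  fixes s A B r\<^sub>0 :: real
  assumes s_pos: "0 < s" and A_pos: "0 < A"
    and prod_ge: "1 \<le> n \<Longrightarrow> A \<le> moran_prod N r s n"
    and prod_le: "1 \<le> n \<Longrightarrow> moran_prod N r s n \<le> B"
    and r\<^sub>0_pos: "0 < r\<^sub>0"
    and r\<^sub>0_le: "1 \<le> n \<Longrightarrow> j \<in> {1..N n} \<Longrightarrow> r\<^sub>0 \<le> r n j"
    and diam_pos: "0 < diameter X"
begin

abbreviation "H \<equiv> moran_prod N r s"

lemma H_pos: "1 \<le> n \<Longrightarrow> 0 < H n"
  using prod_ge A_pos by (meson less_le_trans)

lemma B_pos: "0 < B"
  using prod_le[of 1] H_pos[of 1] by simp

text \<open>Splitting off the first letter loses nothing; this closes the inductions in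
  \<open>level_cover\<close>, \<open>mass_le\<close> and \<open>mass_cover\<close>.\<close>

lemma H_ratio:
  assumes "1 \<le> n"
  shows "(\<Sum>j=1..N n. r n j powr s) * (H (Suc n + m) / H (Suc n)) = H (n + Suc m) / H n"
proof -
  have "H (Suc n) \<noteq> 0" "H n \<noteq> 0" using H_pos[of n] H_pos[of "Suc n"] assms by auto
  then show ?thesis by (simp add: moran_prod_Suc[OF assms] field_simps)
qed

lemma H_ratio_le: "1 \<le> n \<Longrightarrow> H (n + m) / H n \<le> B / A"
  using prod_ge prod_le[of "n + m"] A_pos B_pos by (intro frac_le) auto

lemma H_ratio_ge: "1 \<le> n \<Longrightarrow> A / B \<le> H (n + m) / H n"
  using prod_ge[of "n + m"] prod_le[of n] A_pos H_pos[of n] H_pos[of "n + m"] by (intro frac_le) auto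

text \<open>The pieces are the images of X under the words of length m. Coinciding images are
  counted separately, so the sum factors over the first letter.\<close>

lemma level_cover:
  assumes "1 \<le> n"
  shows "\<exists>Us. limit_set n \<subseteq> \<Union>(set Us) \<and>
    (\<forall>U\<in>set Us. bounded U \<and> diameter U \<le> (\<Prod>i<m. c (n + i)) * diameter X) \<and>
    (\<Sum>U\<leftarrow>Us. diameter U powr s) \<le> H (n + m) / H n * diameter X powr s"
  using assms
proof (induction m arbitrary: n)
  case 0
  then show ?case
    using limit_set_subset_X[of n] compact_imp_bounded[OF compact_X] H_pos[of n]
    by (intro exI[of _ "[X]"]) auto
next
  case (Suc m)
  obtain Us where Us: "limit_set (Suc n) \<subseteq> \<Union>(set Us)"
      "\<And>U. U \<in> set Us \<Longrightarrow> bounded U"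
      "\<And>U. U \<in> set Us \<Longrightarrow> diameter U \<le> (\<Prod>i<m. c (Suc n + i)) * diameter X"
      "(\<Sum>U\<leftarrow>Us. diameter U powr s) \<le> H (Suc n + m) / H (Suc n) * diameter X powr s"
    using Suc.IH[of "Suc n"] by auto
  let ?Us = "concat (map (\<lambda>j. map ((`) (\<phi> n j)) Us) [1..<Suc (N n)])"
  have set_eq: "set ?Us = (\<Union>j\<in>{1..N n}. (`) (\<phi> n j) ` set Us)"
    by (simp add: atLeastLessThanSuc_atLeastAtMost del: upt_Suc)
  have "limit_set n \<subseteq> \<Union>(set ?Us)"
  proof
    fix x assume "x \<in> limit_set n"
    then obtain j y where j: "j \<in> {1..N n}" and y: "y \<in> limit_set (Suc n)" "x = \<phi> n j y"
      using limit_set_subset[OF Suc.prems] by blast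
    obtain U where "U \<in> set Us" "y \<in> U" using y(1) Us(1) by blast
    then show "x \<in> \<Union>(set ?Us)" unfolding set_eq using j y(2) by blast
  qed
  moreover have "bounded U \<and> diameter U \<le> (\<Prod>i<Suc m. c (n + i)) * diameter X" if "U \<in> set ?Us" for U
  proof -
    obtain j W where j: "j \<in> {1..N n}" and W: "W \<in> set Us" "U = \<phi> n j ` W"
      using \<open>U \<in> set ?Us\<close> unfolding set_eq by blast
    have "diameter U \<le> r n j * diameter W"
      using diameter_map(2)[OF Suc.prems j Us(2)] W by simp
    also have "\<dots> \<le> c n * ((\<Prod>i<m. c (Suc n + i)) * diameter X)"
      using Us(2,3) W r_le[OF Suc.prems j] c_pos[OF Suc.prems]
      by (intro mult_mono) (auto intro: diameter_ge_0)
    finally show ?thesis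
      using diameter_map(1)[OF Suc.prems j Us(2)] W by (simp add: c_prod_Suc mult.assoc del: prod.lessThan_Suc)
  qed
  moreover have "(\<Sum>U\<leftarrow>?Us. diameter U powr s) \<le> H (n + Suc m) / H n * diameter X powr s"
  proof -
    have "(\<Sum>U\<leftarrow>?Us. diameter U powr s) = (\<Sum>j\<leftarrow>[1..<Suc (N n)]. \<Sum>U\<leftarrow>Us. diameter (\<phi> n j ` U) powr s)"
      by (simp only: sum_list_concat_map comp_def map_map)
    also have "\<dots> = (\<Sum>j=1..N n. \<Sum>U\<leftarrow>Us. diameter (\<phi> n j ` U) powr s)"
      by (simp only: interv_sum_list_conv_sum_set_nat set_upt atLeastLessThanSuc_atLeastAtMost)
    also have "\<dots> \<le> (\<Sum>j=1..N n. \<Sum>U\<leftarrow>Us. r n j powr s * diameter U powr s)"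
    proof (intro sum_mono sum_list_mono)
      fix j U assume j: "j \<in> {1..N n}" and U: "U \<in> set Us"
      have "diameter (\<phi> n j ` U) powr s \<le> (r n j * diameter U) powr s"
        using diameter_map[OF Suc.prems j Us(2)[OF U]] s_pos
        by (intro powr_mono2) (auto intro: diameter_ge_0)
      then show "diameter (\<phi> n j ` U) powr s \<le> r n j powr s * diameter U powr s"
        using r_pos[OF Suc.prems j] diameter_ge_0[OF Us(2)[OF U]] by (simp add: powr_mult)
    qed
    also have "\<dots> = (\<Sum>j=1..N n. r n j powr s) * (\<Sum>U\<leftarrow>Us. diameter U powr s)"
      by (simp add: sum_list_const_mult sum_distrib_right)
    also have "\<dots> \<le> (\<Sum>j=1..N n. r n j powr s) * (H (Suc n + m) / H (Suc n) * diameter X powr s)"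
      using Us(4) by (intro mult_left_mono) (auto intro: sum_nonneg)
    also have "\<dots> = H (n + Suc m) / H n * diameter X powr s"
      by (simp only: mult.assoc [symmetric] H_ratio[OF Suc.prems])
    finally show ?thesis .
  qed
  ultimately show ?case by blast
qed

lemma hausdorff_measure_limit_set_le:
  assumes "1 \<le> n"
  shows "hausdorff_measure s (limit_set n) \<le> ennreal (B / A * diameter X powr s)"
proof (rule hausdorff_measure_least[of 1])
  fix \<delta> :: real assume "0 < \<delta>"
  have "(\<lambda>m. (\<Prod>i<m. c (n + i)) * diameter X) \<longlonglongrightarrow> 0"
    using c_prod_lim[OF assms] by (rule tendsto_mult_left_zero)
  then have "\<forall>\<^sub>F m in sequentially. (\<Prod>i<m. c (n + i)) * diameter X < \<delta>"
    using \<open>0 < \<delta>\<close> by (rule order_tendstoD)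
  then obtain m where m: "(\<Prod>i<m. c (n + i)) * diameter X < \<delta>"
    by (meson eventually_happens trivial_limit_sequentially)
  obtain Us where Us: "limit_set n \<subseteq> \<Union>(set Us)"
      "\<And>U. U \<in> set Us \<Longrightarrow> bounded U"
      "\<And>U. U \<in> set Us \<Longrightarrow> diameter U \<le> (\<Prod>i<m. c (n + i)) * diameter X"
      "(\<Sum>U\<leftarrow>Us. diameter U powr s) \<le> H (n + m) / H n * diameter X powr s"
    using level_cover[OF assms, of m] by auto
  have "hausdorff_premeasure \<delta> s (limit_set n) \<le> (\<Sum>U\<leftarrow>Us. diam_power s U)"
    using Us(1,2) order_trans[OF Us(3) less_imp_le[OF m]] \<open>0 < \<delta>\<close>
    by (intro hausdorff_premeasure_le_sum_list) auto
  also have "\<dots> = ennreal (\<Sum>U\<leftarrow>Us. diameter U powr s)"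
    using s_pos by (simp add: diam_power_pos sum_list_ennreal)
  also have "\<dots> \<le> ennreal (B / A * diameter X powr s)"
    using order_trans[OF Us(4) mult_right_mono[OF H_ratio_le[OF assms]]] by (intro ennreal_leI) simp
  finally show "hausdorff_premeasure \<delta> s (limit_set n) \<le> ennreal (B / A * diameter X powr s)" .
qed simp

text \<open>The weight \<^term>\<open>1 / H n\<close> makes the bound reproduce itself exactly when the first letter is
  split off, although the branches are stopped at different levels.\<close>

lemma stopping_cover:
  assumes "1 \<le> n" "0 < \<delta>" "\<delta> \<le> diameter X / r\<^sub>0" "(\<Prod>i<m. c (n + i)) * diameter X \<le> \<delta>"
  shows "\<exists>C. finite C \<and> limit_set n \<subseteq> \<Union>C \<and> (\<forall>U\<in>C. bounded U \<and> diameter U \<le> \<delta>) \<and>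
    real (card C) \<le> B * (diameter X / r\<^sub>0) powr s * \<delta> powr - s / H n"
  using assms
proof (induction m arbitrary: n \<delta>)
  \<comment> \<open>A stopped branch is covered by X alone. The bound is then at least 1:
    \<open>\<delta>\<close> does not exceed \<open>diameter X / r\<^sub>0\<close>, and H is at most
    B.\<close>
  have base: "\<exists>C. finite C \<and> limit_set n \<subseteq> \<Union>C \<and> (\<forall>U\<in>C. bounded U \<and> diameter U \<le> \<delta>) \<and>
      real (card C) \<le> B * (diameter X / r\<^sub>0) powr s * \<delta> powr - s / H n"
    if "1 \<le> n" "0 < \<delta>" "\<delta> \<le> diameter X / r\<^sub>0" "diameter X \<le> \<delta>" for n \<delta>
  proof (intro exI conjI)
    have "\<delta> powr s \<le> (diameter X / r\<^sub>0) powr s"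
      using that s_pos by (intro powr_mono2) auto
    then have "1 \<le> (diameter X / r\<^sub>0) powr s * \<delta> powr - s"
      using that(2) by (simp add: powr_minus field_simps)
    moreover have "1 \<le> B / H n"
      using prod_le[OF that(1)] H_pos[OF that(1)] by simp
    ultimately have "1 * 1 \<le> B / H n * ((diameter X / r\<^sub>0) powr s * \<delta> powr - s)"
      by (intro mult_mono) auto
    then show "real (card {X}) \<le> B * (diameter X / r\<^sub>0) powr s * \<delta> powr - s / H n" by simp
  qed (use that limit_set_subset_X compact_imp_bounded[OF compact_X] in auto)
  {
    case (0 n \<delta>)
    then show ?case by (intro base) simp_all
  next
    case (Suc m n \<delta>)
    show ?case
    proof (cases "diameter X \<le> \<delta>")
      case False
      have "\<forall>j\<in>{1..N n}. \<exists>C. finite C \<and> limit_set (Suc n) \<subseteq> \<Union>C \<and>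
          (\<forall>U\<in>C. bounded U \<and> diameter U \<le> \<delta> / r n j) \<and>
          real (card C) \<le> B * (diameter X / r\<^sub>0) powr s * (\<delta> / r n j) powr - s / H (Suc n)"
      proof (intro ballI Suc.IH)
        fix j assume j: "j \<in> {1..N n}"
        have r: "0 < r n j" "r\<^sub>0 \<le> r n j" "r n j \<le> c n"
          using r_pos r\<^sub>0_le r_le Suc.prems(1) j by auto
        show "0 < \<delta> / r n j" using r Suc.prems(2) by simp
        show "\<delta> / r n j \<le> diameter X / r\<^sub>0"
          using False r r\<^sub>0_pos Suc.prems(2) by (intro frac_le) auto
        have "(\<Prod>i<m. c (Suc n + i)) * diameter X \<le> \<delta> / c n"
          using Suc.prems(4) c_pos[OF Suc.prems(1)] unfolding c_prod_Suc by (simp add: field_simps)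
        also have "\<dots> \<le> \<delta> / r n j"
          using r Suc.prems(2) by (intro divide_left_mono) auto
        finally show "(\<Prod>i<m. c (Suc n + i)) * diameter X \<le> \<delta> / r n j" .
      qed simp
      from bchoice[OF this] obtain C where C_all: "\<forall>j\<in>{1..N n}. finite (C j) \<and> limit_set (Suc n) \<subseteq> \<Union>(C j) \<and>
          (\<forall>U\<in>C j. bounded U \<and> diameter U \<le> \<delta> / r n j) \<and>
          real (card (C j)) \<le> B * (diameter X / r\<^sub>0) powr s * (\<delta> / r n j) powr - s / H (Suc n)" ..
      have C: "finite (C j)" "limit_set (Suc n) \<subseteq> \<Union>(C j)"
          "\<And>U. U \<in> C j \<Longrightarrow> bounded U" "\<And>U. U \<in> C j \<Longrightarrow> diameter U \<le> \<delta> / r n j"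
          "real (card (C j)) \<le> B * (diameter X / r\<^sub>0) powr s * (\<delta> / r n j) powr - s / H (Suc n)"
        if "j \<in> {1..N n}" for j
        using bspec[OF C_all that] by simp_all
      let ?C = "\<Union>j\<in>{1..N n}. (`) (\<phi> n j) ` C j"
      show ?thesis
      proof (intro exI conjI ballI)
        show "finite ?C" using C(1) by blast
        show "limit_set n \<subseteq> \<Union>?C"
        proof
          fix x assume "x \<in> limit_set n"
          then obtain j y where j: "j \<in> {1..N n}" and y: "y \<in> limit_set (Suc n)" "x = \<phi> n j y"
            using limit_set_subset[OF Suc.prems(1)] by blast
          obtain U where "U \<in> C j" "y \<in> U" using y(1) C(2)[OF j] by blast
          then show "x \<in> \<Union>?C" using j y(2) by blast
        qed
        fix U assume "U \<in> ?C"
        then obtain j W where j: "j \<in> {1..N n}" and W: "W \<in> C j" "U = \<phi> n j ` W" by blast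
        note W' = C(3)[OF j W(1)]
        show "bounded U" unfolding W(2) by (rule diameter_map[OF Suc.prems(1) j W'])
        have "diameter U \<le> r n j * diameter W" unfolding W(2) by (rule diameter_map[OF Suc.prems(1) j W'])
        also have "\<dots> \<le> \<delta>"
          using C(4)[OF j W(1)] r_pos[OF Suc.prems(1) j] by (simp add: field_simps)
        finally show "diameter U \<le> \<delta>" .
      next
        have "card ?C \<le> (\<Sum>j=1..N n. card (C j))"
          using C(1) by (intro order_trans[OF card_UN_le] sum_mono card_image_le) auto
        then have "real (card ?C) \<le> (\<Sum>j=1..N n. real (card (C j)))"
          by (metis of_nat_mono of_nat_sum)
        also have "\<dots> \<le> (\<Sum>j=1..N n. B * (diameter X / r\<^sub>0) powr s * \<delta> powr - s / H (Suc n) * r n j powr s)"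
        proof (intro sum_mono)
          fix j assume j: "j \<in> {1..N n}"
          have "(\<delta> / r n j) powr - s = \<delta> powr - s * r n j powr s"
            using r_pos[OF Suc.prems(1) j] Suc.prems(2) by (simp add: powr_divide powr_minus field_simps)
          then show "real (card (C j)) \<le> B * (diameter X / r\<^sub>0) powr s * \<delta> powr - s / H (Suc n) * r n j powr s"
            using C(5)[OF j] by (simp add: mult_ac)
        qed
        also have "\<dots> = B * (diameter X / r\<^sub>0) powr s * \<delta> powr - s / H (Suc n) * (\<Sum>j=1..N n. r n j powr s)"
          by (rule sum_distrib_left [symmetric])
        also have "\<dots> = B * (diameter X / r\<^sub>0) powr s * \<delta> powr - s / H n"
          using H_pos[of "Suc n"] unfolding moran_prod_Suc[OF Suc.prems(1)] by auto
        finally show "real (card ?C) \<le> B * (diameter X / r\<^sub>0) powr s * \<delta> powr - s / H n" .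
      qed
    qed (use base Suc.prems in blast)
  }
qed

lemma limit_set_cover:
  assumes "1 \<le> n" "0 < \<delta>" "\<delta> \<le> diameter X / r\<^sub>0"
  shows "\<exists>C. finite C \<and> limit_set n \<subseteq> \<Union>C \<and> (\<forall>U\<in>C. bounded U \<and> diameter U \<le> \<delta>) \<and>
    real (card C) \<le> B * (diameter X / r\<^sub>0) powr s * \<delta> powr - s / H n"
proof -
  have "(\<lambda>m. (\<Prod>i<m. c (n + i)) * diameter X) \<longlonglongrightarrow> 0"
    using c_prod_lim[OF assms(1)] by (rule tendsto_mult_left_zero)
  then have "\<forall>\<^sub>F m in sequentially. (\<Prod>i<m. c (n + i)) * diameter X < \<delta>"
    using \<open>0 < \<delta>\<close> by (rule order_tendstoD)
  then obtain m where "(\<Prod>i<m. c (n + i)) * diameter X < \<delta>"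
    by (meson eventually_happens trivial_limit_sequentially)
  then show ?thesis using stopping_cover[OF assms, of m] by simp
qed

lemma covering_number_limit_set_le:
  assumes "1 \<le> n" "0 < \<delta>" "\<delta> \<le> diameter X / r\<^sub>0"
  shows "real (covering_number \<delta> (limit_set n)) \<le> B * (diameter X / r\<^sub>0) powr s / H n * \<delta> powr - s"
proof -
  obtain C where C: "finite C" "limit_set n \<subseteq> \<Union>C" "\<forall>U\<in>C. bounded U \<and> diameter U \<le> \<delta>"
      "real (card C) \<le> B * (diameter X / r\<^sub>0) powr s * \<delta> powr - s / H n"
    using limit_set_cover[OF assms] by blast
  have "covering_number \<delta> (limit_set n) \<le> card C"
    using C(1-3) by (intro covering_number_le) auto
  with C(4) show ?thesis by (simp add: mult_ac)
qed

end

section \<open>Lower bounds\<close>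

locale moran_open_set_system = bounded_similarity_system X N r \<phi> c s A B r\<^sub>0
  for X :: "'a::euclidean_space set" and N r \<phi> c s A B r\<^sub>0 +
  fixes V :: "nat \<Rightarrow> 'a set" and v\<^sub>0 :: real
  assumes surj_map: "1 \<le> n \<Longrightarrow> j \<in> {1..N n} \<Longrightarrow> surj (\<phi> n j)"
    and open_V: "1 \<le> n \<Longrightarrow> open (V n)"
    and V_subset: "1 \<le> n \<Longrightarrow> V n \<subseteq> X"
    and map_V: "1 \<le> n \<Longrightarrow> j \<in> {1..N n} \<Longrightarrow> \<phi> n j ` V (Suc n) \<subseteq> V n"
    and disjoint_V: "1 \<le> n \<Longrightarrow> i \<in> {1..N n} \<Longrightarrow> j \<in> {1..N n} \<Longrightarrow> i \<noteq> j \<Longrightarrow>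
      \<phi> n i ` V (Suc n) \<inter> \<phi> n j ` V (Suc n) = {}"
    and v\<^sub>0_pos: "0 < v\<^sub>0"
    and v\<^sub>0_le: "1 \<le> n \<Longrightarrow> v\<^sub>0 \<le> measure lebesgue (V n)"
begin

text \<open>Sum of the \<open>s\<close>-th powers of the ratios of the words of length \<open>m\<close> starting at level \<open>n\<close>
  whose cylinders meet \<open>U\<close>; pulling \<open>U\<close> back along the first letter avoids the words.\<close>

primrec mass :: "nat \<Rightarrow> nat \<Rightarrow> 'a set \<Rightarrow> real" where
  "mass 0 n U = (if U \<inter> X = {} then 0 else 1)"
| "mass (Suc m) n U = (\<Sum>j=1..N n. r n j powr s * mass m (Suc n) (\<phi> n j -` U))"

lemma mass_nonneg: "0 \<le> mass m n U"
  by (induction m arbitrary: n U) (auto intro: sum_nonneg)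

lemma mass_le:
  assumes "1 \<le> n"
  shows "mass m n U \<le> H (n + m) / H n"
  using assms
proof (induction m arbitrary: n U)
  case 0
  then show ?case using H_pos[of n] by simp
next
  case (Suc m)
  have "mass (Suc m) n U \<le> (\<Sum>j=1..N n. r n j powr s * (H (Suc n + m) / H (Suc n)))"
    unfolding mass.simps by (intro sum_mono mult_left_mono Suc.IH) auto
  also have "\<dots> = H (n + Suc m) / H n"
    by (simp only: sum_distrib_right [symmetric] H_ratio[OF Suc.prems])
  finally show ?case .
qed

lemma mass_eq_0:
  assumes "1 \<le> n" "U \<inter> X = {}"
  shows "mass m n U = 0"
  using assms
proof (induction m arbitrary: n U)
  case (Suc m)
  have "mass m (Suc n) (\<phi> n j -` U) = 0" if "j \<in> {1..N n}" for j
  proof (rule Suc.IH)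
    show "\<phi> n j -` U \<inter> X = {}" using map_X[OF Suc.prems(1) that] Suc.prems(2) by blast
  qed simp
  then show ?case by simp
qed simp

text \<open>Every cylinder contains a point of the limit set and so meets some \<open>U i\<close>;
  hence no word goes uncounted. In the induction the pulled-back sets cover the next limit set,
  because each map sends that set into the present one.\<close>

lemma mass_cover:
  assumes "1 \<le> n" "finite I" "limit_set n \<subseteq> (\<Union>i\<in>I. U i)"
  shows "H (n + m) / H n \<le> (\<Sum>i\<in>I. mass m n (U i))"
  using assms(1,3)
proof (induction m arbitrary: n U)
  case 0
  obtain x where x: "x \<in> limit_set n" using limit_set_nonempty[OF 0(1)] by blast
  then obtain k where k: "k \<in> I" "x \<in> U k" using 0(2) by blast
  then have "mass 0 n (U k) = 1" using x limit_set_subset_X[of n] by auto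
  then have "1 \<le> (\<Sum>i\<in>I. mass 0 n (U i))"
    using member_le_sum[of k I "\<lambda>i. mass 0 n (U i)"] k(1) assms(2) mass_nonneg by (simp del: mass.simps)
  then show ?case using H_pos[OF 0(1)] by simp
next
  case (Suc m)
  have "H (n + Suc m) / H n = (\<Sum>j=1..N n. r n j powr s * (H (Suc n + m) / H (Suc n)))"
    by (simp only: sum_distrib_right [symmetric] H_ratio[OF Suc.prems(1)])
  also have "\<dots> \<le> (\<Sum>j=1..N n. r n j powr s * (\<Sum>i\<in>I. mass m (Suc n) (\<phi> n j -` U i)))"
  proof (intro sum_mono mult_left_mono Suc.IH)
    fix j assume j: "j \<in> {1..N n}"
    have "\<phi> n j ` limit_set (Suc n) \<subseteq> (\<Union>i\<in>I. U i)"
      using image_limit_set_subset[OF Suc.prems(1) j] Suc.prems(2) by (rule order_trans)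
    then show "limit_set (Suc n) \<subseteq> (\<Union>i\<in>I. \<phi> n j -` U i)" by blast
  qed auto
  also have "\<dots> = (\<Sum>i\<in>I. mass (Suc m) n (U i))"
    unfolding mass.simps sum_distrib_left by (rule sum.swap)
  finally show ?case .
qed

section \<open>Balls and volumes under the maps\<close>

lemma vimage_ball:
  assumes "1 \<le> n" "j \<in> {1..N n}"
  shows "\<phi> n j -` ball (\<phi> n j y) \<rho> = ball y (\<rho> / r n j)"
  using r_pos[OF assms] by (auto simp: dist_map[OF assms] field_simps)

lemma open_image_map:
  assumes "1 \<le> n" "j \<in> {1..N n}" "open S"
  shows "open (\<phi> n j ` S)"
  unfolding open_contains_ball
proof
  fix z assume "z \<in> \<phi> n j ` S"
  then obtain y where y: "y \<in> S" "z = \<phi> n j y" by blast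
  obtain e where e: "0 < e" "ball y e \<subseteq> S" using \<open>open S\<close> y(1) by (rule openE)
  have "\<phi> n j -` ball z (r n j * e) \<subseteq> S"
    using vimage_ball[OF assms(1,2), of y "r n j * e"] r_pos[OF assms(1,2)] e(2) y(2) by simp
  then have "ball z (r n j * e) \<subseteq> \<phi> n j ` S"
    using surj_map[OF assms(1,2)] by (metis image_mono surj_image_vimage_eq)
  then show "\<exists>e>0. ball z e \<subseteq> \<phi> n j ` S"
    using e(1) r_pos[OF assms(1,2)] by (intro exI[of _ "r n j * e"]) simp
qed

lemma measure_image_map_ge:
  assumes "1 \<le> n" "j \<in> {1..N n}" "open S" "bounded S"
  shows "r n j ^ DIM('a) * measure lebesgue S \<le> measure lebesgue (\<phi> n j ` S)"
proof -
  have m: "S \<in> lmeasurable" "\<phi> n j ` S \<in> lmeasurable"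
    using assms open_image_map diameter_map(1) by (auto intro!: lmeasurable_open)
  have "ennreal (r n j ^ DIM('a)) * emeasure lebesgue S \<le> emeasure lebesgue (\<phi> n j ` S)"
    using assms by (intro emeasure_similarity_image_ge r_pos dist_map surj_map)
  then have "ennreal (r n j ^ DIM('a) * measure lebesgue S) \<le> ennreal (measure lebesgue (\<phi> n j ` S))"
    using m r_pos[OF assms(1,2)] by (simp add: emeasure_eq_measure2 ennreal_mult')
  then show ?thesis by simp
qed

text \<open>Induction on the first letter: a similarity scales the radius by \<^term>\<open>1 / r n j\<close>, and the
  images of the open sets are disjoint, so the volumes on the right-hand side add up.  The
  induction stops once the radius exceeds 1.\<close>

lemma mass_ball_le:
  assumes "1 \<le> n" "0 < \<rho>" "\<rho> \<le> 1 / r\<^sub>0" "(\<Prod>i<m. c (n + i)) \<le> \<rho>"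
  shows "mass m n (ball x \<rho>) \<le> B / A / (v\<^sub>0 * r\<^sub>0 ^ DIM('a)) * \<rho> powr (s - DIM('a)) *
    measure lebesgue (V n \<inter> ball x ((2 + diameter X) * \<rho>))"
  using assms
proof (induction m arbitrary: n \<rho> x)
  let ?D = "DIM('a)" and ?L = "2 + diameter X"
  let ?k = "B / A / (v\<^sub>0 * r\<^sub>0 ^ ?D)"
  have k_nonneg: "0 \<le> ?k" using A_pos B_pos v\<^sub>0_pos r\<^sub>0_pos by simp
  \<comment> \<open>For a radius of at least 1, the enlarged ball contains X whenever the ball meets
    X, and hence all of \<open>V n\<close>, whose volume is at least \<open>v\<^sub>0\<close>. The
    constant \<open>?k\<close> is chosen so that the right-hand side then reaches
    \<open>B / A\<close>, a bound for the total weight.\<close>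
  have base: "mass m n (ball x \<rho>) \<le> ?k * \<rho> powr (s - ?D) * measure lebesgue (V n \<inter> ball x (?L * \<rho>))"
    if n: "1 \<le> n" and \<rho>: "1 \<le> \<rho>" "\<rho> \<le> 1 / r\<^sub>0" for m n x \<rho>
  proof (cases "ball x \<rho> \<inter> X = {}")
    case True
    show ?thesis unfolding mass_eq_0[OF n True] using k_nonneg by (intro mult_nonneg_nonneg) auto
  next
    case False
    then obtain y where y: "y \<in> X" "dist x y < \<rho>" by auto
    have "dist x z < ?L * \<rho>" if "z \<in> X" for z
    proof -
      have "dist y z \<le> diameter X"
        using y that compact_imp_bounded[OF compact_X] by (intro diameter_bounded_bound)
      also have "\<dots> \<le> diameter X * \<rho>" using \<rho> diam_pos by simp
      finally have "dist y z \<le> diameter X * \<rho>" .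
      then show ?thesis using dist_triangle[of x z y] y \<rho> by (simp add: distrib_right)
    qed
    then have V_eq: "V n \<inter> ball x (?L * \<rho>) = V n" using V_subset[OF n] by auto
    \<comment> \<open>The sign of s - d is not known; as s is positive and \<rho> at least 1, the
      exponent can be lowered to -d.\<close>
    have "\<rho> powr (s - ?D) \<ge> r\<^sub>0 ^ ?D"
    proof -
      have "r\<^sub>0 ^ ?D \<le> (1 / \<rho>) ^ ?D"
        using \<rho> r\<^sub>0_pos by (intro power_mono) (auto simp: field_simps)
      also have "\<dots> = \<rho> powr (- ?D)"
        using \<rho> by (simp add: powr_minus powr_realpow power_one_over field_simps)
      also have "\<dots> \<le> \<rho> powr (s - ?D)" using \<rho> s_pos by (intro powr_mono) auto
      finally show ?thesis .
    qed
    then have "r\<^sub>0 ^ ?D * v\<^sub>0 \<le> \<rho> powr (s - ?D) * measure lebesgue (V n)"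
      using v\<^sub>0_le[OF n] v\<^sub>0_pos by (intro mult_mono) auto
    then have "?k * (r\<^sub>0 ^ ?D * v\<^sub>0) \<le> ?k * (\<rho> powr (s - ?D) * measure lebesgue (V n))"
      using k_nonneg by (rule mult_left_mono)
    moreover have "?k * (r\<^sub>0 ^ ?D * v\<^sub>0) = B / A"
      using r\<^sub>0_pos v\<^sub>0_pos by simp
    ultimately show ?thesis
      using mass_le[OF n, of m "ball x \<rho>"] H_ratio_le[OF n, of m] by (simp add: V_eq mult.assoc)
  qed
  {
    case (0 n \<rho> x)
    then show ?case by (intro base) simp_all
  next
    case (Suc m n \<rho> x)
    show ?case
    proof (cases "1 \<le> \<rho>")
      case False
      \<comment> \<open>By surjectivity every centre has a preimage, so the pulled-back ball is
        again a ball; its centre may lie outside X.\<close>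
      define y where "y j = inv (\<phi> n j) x" for j
      have y: "\<phi> n j (y j) = x" if "j \<in> {1..N n}" for j
        unfolding y_def using surj_map[OF Suc.prems(1) that] by (rule surj_f_inv_f)
      define S where "S j = V (Suc n) \<inter> ball (y j) (?L * (\<rho> / r n j))" for j
      have S: "open (S j)" "bounded (S j)" "\<phi> n j ` S j \<in> lmeasurable" if "j \<in> {1..N n}" for j
      proof -
        show "open (S j)" "bounded (S j)"
          unfolding S_def using open_V[of "Suc n"] by (auto intro: bounded_subset[OF bounded_ball])
        then show "\<phi> n j ` S j \<in> lmeasurable"
          using open_image_map[OF Suc.prems(1) that] diameter_map(1)[OF Suc.prems(1) that]
          by (intro lmeasurable_open)
      qed
      have "mass (Suc m) n (ball x \<rho>) = (\<Sum>j=1..N n. r n j powr s * mass m (Suc n) (ball (y j) (\<rho> / r n j)))"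
        unfolding mass.simps using y vimage_ball[OF Suc.prems(1)] by (intro sum.cong) metis+
      also have "\<dots> \<le> (\<Sum>j=1..N n. ?k * \<rho> powr (s - ?D) * measure lebesgue (\<phi> n j ` S j))"
      proof (intro sum_mono)
        fix j assume j: "j \<in> {1..N n}"
        have r: "0 < r n j" "r\<^sub>0 \<le> r n j" "r n j \<le> c n"
          using r_pos r\<^sub>0_le r_le Suc.prems(1) j by auto
        have "mass m (Suc n) (ball (y j) (\<rho> / r n j))
            \<le> ?k * (\<rho> / r n j) powr (s - ?D) * measure lebesgue (S j)"
          unfolding S_def
        proof (rule Suc.IH)
          show "0 < \<rho> / r n j" using r Suc.prems(2) by simp
          show "\<rho> / r n j \<le> 1 / r\<^sub>0"
            using False r r\<^sub>0_pos Suc.prems(2) by (intro frac_le) auto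
          have "(\<Prod>i<m. c (Suc n + i)) \<le> \<rho> / c n"
            using Suc.prems(4) c_pos[OF Suc.prems(1)] unfolding c_prod_Suc by (simp add: field_simps)
          also have "\<dots> \<le> \<rho> / r n j"
            using r Suc.prems(2) by (intro divide_left_mono) auto
          finally show "(\<Prod>i<m. c (Suc n + i)) \<le> \<rho> / r n j" .
        qed simp
        then have "r n j powr s * mass m (Suc n) (ball (y j) (\<rho> / r n j))
            \<le> r n j powr s * (?k * (\<rho> / r n j) powr (s - ?D) * measure lebesgue (S j))"
          by (intro mult_left_mono) auto
        \<comment> \<open>The powers of the ratio with exponent s cancel, and what remains is its
          d-th power, the volume factor of the map. This is what dictates the form
          \<open>\<rho> powr (s - d)\<close> times a volume.\<close>
        also have "\<dots> = ?k * \<rho> powr (s - ?D) * (r n j ^ ?D * measure lebesgue (S j))"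
        proof -
          have "r n j powr s * (\<rho> / r n j) powr (s - ?D) = \<rho> powr (s - ?D) * r n j ^ ?D"
            using r Suc.prems(2)
            by (simp add: powr_divide powr_diff powr_realpow field_simps)
          then show ?thesis by (simp add: mult_ac)
        qed
        also have "\<dots> \<le> ?k * \<rho> powr (s - ?D) * measure lebesgue (\<phi> n j ` S j)"
          using measure_image_map_ge[OF Suc.prems(1) j S(1,2)[OF j]] k_nonneg
          by (intro mult_left_mono mult_nonneg_nonneg) auto
        finally show "r n j powr s * mass m (Suc n) (ball (y j) (\<rho> / r n j))
            \<le> ?k * \<rho> powr (s - ?D) * measure lebesgue (\<phi> n j ` S j)" .
      qed
      also have "\<dots> = ?k * \<rho> powr (s - ?D) * measure lebesgue (\<Union>j\<in>{1..N n}. \<phi> n j ` S j)"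
      proof -
        have "pairwise (\<lambda>i j. disjnt (\<phi> n i ` S i) (\<phi> n j ` S j)) {1..N n}"
        proof (rule pairwiseI)
          fix i j assume ij: "i \<in> {1..N n}" "j \<in> {1..N n}" "i \<noteq> j"
          have "\<phi> n i ` S i \<subseteq> \<phi> n i ` V (Suc n)" "\<phi> n j ` S j \<subseteq> \<phi> n j ` V (Suc n)"
            unfolding S_def by auto
          with disjoint_V[OF Suc.prems(1) ij] show "disjnt (\<phi> n i ` S i) (\<phi> n j ` S j)"
            unfolding disjnt_def by blast
        qed
        then have "measure lebesgue (\<Union>j\<in>{1..N n}. \<phi> n j ` S j) = (\<Sum>j=1..N n. measure lebesgue (\<phi> n j ` S j))"
          using S(3) by (intro measure_UNION') auto
        then show ?thesis by (simp only: sum_distrib_left)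
      qed
      also have "\<dots> \<le> ?k * \<rho> powr (s - ?D) * measure lebesgue (V n \<inter> ball x (?L * \<rho>))"
      proof (intro mult_left_mono measure_mono_fmeasurable mult_nonneg_nonneg)
        show "(\<Union>j\<in>{1..N n}. \<phi> n j ` S j) \<subseteq> V n \<inter> ball x (?L * \<rho>)"
        proof (intro UN_least Int_greatest)
          fix j assume j: "j \<in> {1..N n}"
          show "\<phi> n j ` S j \<subseteq> V n" using map_V[OF Suc.prems(1) j] unfolding S_def by blast
          have "\<phi> n j -` ball x (?L * \<rho>) = ball (y j) (?L * (\<rho> / r n j))"
            using vimage_ball[OF Suc.prems(1) j, of "y j" "?L * \<rho>"] y[OF j] by simp
          then show "\<phi> n j ` S j \<subseteq> ball x (?L * \<rho>)" unfolding S_def by blast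
        qed
        show "(\<Union>j\<in>{1..N n}. \<phi> n j ` S j) \<in> sets lebesgue"
          using S(3) by (intro sets.finite_UN) (auto dest: fmeasurableD)
        show "V n \<inter> ball x (?L * \<rho>) \<in> lmeasurable"
          using open_V[OF Suc.prems(1)] by (intro lmeasurable_open) (auto intro: bounded_subset[OF bounded_ball])
      qed (use k_nonneg in simp_all)
      finally show ?thesis .
    qed (use base Suc.prems in blast)
  }
qed

text \<open>The constant of \<open>mass_ball_le\<close> times the volume of a ball of radius
  \<open>2 + diameter X\<close>; it does not depend on the level.\<close>

definition mass_constant :: real where
  "mass_constant = B / A / (v\<^sub>0 * r\<^sub>0 ^ DIM('a)) * unit_ball_vol (DIM('a)) * (2 + diameter X) ^ DIM('a)"

lemma mass_constant_pos: "0 < mass_constant"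
  unfolding mass_constant_def using A_pos B_pos v\<^sub>0_pos r\<^sub>0_pos diam_pos
  by (intro mult_pos_pos divide_pos_pos zero_less_power) auto

lemma mass_ball_le_powr:
  assumes "1 \<le> n" "0 < \<rho>" "\<rho> \<le> 1 / r\<^sub>0" "(\<Prod>i<m. c (n + i)) \<le> \<rho>"
  shows "mass m n (ball x \<rho>) \<le> mass_constant * \<rho> powr s"
proof -
  let ?D = "DIM('a)" and ?R = "(2 + diameter X) * \<rho>"
  let ?k = "B / A / (v\<^sub>0 * r\<^sub>0 ^ ?D)"
  have "measure lebesgue (V n \<inter> ball x ?R) \<le> measure lebesgue (ball x ?R)"
    using open_V[OF assms(1)] by (intro measure_mono_fmeasurable) auto
  also have "\<dots> = unit_ball_vol ?D * (2 + diameter X) ^ ?D * \<rho> powr ?D"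
    using assms(2) diam_pos by (simp add: content_ball power_mult_distrib powr_realpow)
  finally have vol: "measure lebesgue (V n \<inter> ball x ?R) \<le> unit_ball_vol ?D * (2 + diameter X) ^ ?D * \<rho> powr ?D" .
  have "mass m n (ball x \<rho>) \<le> ?k * \<rho> powr (s - ?D) * measure lebesgue (V n \<inter> ball x ?R)"
    using assms by (rule mass_ball_le)
  also have "\<dots> \<le> ?k * \<rho> powr (s - ?D) * (unit_ball_vol ?D * (2 + diameter X) ^ ?D * \<rho> powr ?D)"
    using vol A_pos B_pos v\<^sub>0_pos r\<^sub>0_pos by (intro mult_left_mono mult_nonneg_nonneg) auto
  also have "\<dots> = mass_constant * (\<rho> powr (s - ?D) * \<rho> powr ?D)"
    by (simp add: mass_constant_def)
  also have "\<rho> powr (s - ?D) * \<rho> powr ?D = \<rho> powr s"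
    by (simp flip: powr_add)
  finally show ?thesis .
qed

text \<open>Finitely many radii admit a common word length m for which
  \<open>mass_ball_le_powr\<close> applies to every ball; at that length the masses together reach
  the total weight.\<close>

lemma sum_radii_ge:
  assumes n: "1 \<le> n" and I: "finite I" and cover: "limit_set n \<subseteq> (\<Union>i\<in>I. ball (x i) (\<rho> i))"
    and \<rho>: "\<And>i. i \<in> I \<Longrightarrow> 0 < \<rho> i" "\<And>i. i \<in> I \<Longrightarrow> \<rho> i \<le> 1 / r\<^sub>0"
  shows "A / B / mass_constant \<le> (\<Sum>i\<in>I. \<rho> i powr s)"
proof -
  have "\<forall>\<^sub>F m in sequentially. \<forall>i\<in>I. (\<Prod>k<m. c (n + k)) < \<rho> i"
    using order_tendstoD(2)[OF c_prod_lim[OF n] \<rho>(1)] I by (intro eventually_ball_finite) auto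
  then obtain m where m: "\<forall>i\<in>I. (\<Prod>k<m. c (n + k)) < \<rho> i"
    unfolding eventually_sequentially by blast
  have "A / B \<le> H (n + m) / H n" using n by (rule H_ratio_ge)
  also have "\<dots> \<le> (\<Sum>i\<in>I. mass m n (ball (x i) (\<rho> i)))"
    using n I cover by (rule mass_cover)
  also have "\<dots> \<le> (\<Sum>i\<in>I. mass_constant * \<rho> i powr s)"
    using m \<rho> n by (intro sum_mono mass_ball_le_powr) (auto intro: less_imp_le)
  also have "\<dots> = mass_constant * (\<Sum>i\<in>I. \<rho> i powr s)" by (rule sum_distrib_left [symmetric])
  finally show ?thesis
    unfolding pos_divide_le_eq[OF mass_constant_pos] by (simp only: mult.commute)
qed

text \<open>Extracting a finite subcover requires open sets, so each \<open>U i\<close> is enlarged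
  to an open ball at a total cost of at most e. The bound is kept at the scale \<delta> because the
  box dimensions use it there.\<close>

lemma hausdorff_premeasure_limit_set_ge:
  assumes n: "1 \<le> n" and \<delta>: "\<delta> < 1 / r\<^sub>0"
  shows "ennreal (A / B / mass_constant) \<le> hausdorff_premeasure \<delta> s (limit_set n)"
proof (rule hausdorff_premeasure_greatest)
  fix U assume U: "limit_set n \<subseteq> (\<Union>i::nat. U i)" "\<And>i. bounded (U i)" "\<And>i. diameter (U i) \<le> \<delta>"
  show "ennreal (A / B / mass_constant) \<le> (\<Sum>i. diam_power s (U i))"
  proof (rule ennreal_le_epsilon)
    fix e :: real assume e: "0 < e"
    \<comment> \<open>A strictly larger radius is positive even for sets of diameter 0; continuity
      of the power at the diameter, which at 0 relies on s being positive, keeps the i-th excess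
      below a term of a geometric series with sum e.\<close>
    have "\<exists>\<rho> > diameter (U i). \<rho> \<le> 1 / r\<^sub>0 \<and> \<rho> powr s \<le> diameter (U i) powr s + e * (1 / 2) ^ Suc i" for i
    proof -
      let ?d = "diameter (U i)"
      have d: "0 \<le> ?d" using U(2) by (rule diameter_ge_0)
      have "((\<lambda>\<rho>. \<rho> powr s) \<longlongrightarrow> ?d powr s) (at_right ?d)"
        using s_pos d by (intro tendsto_powr' tendsto_const tendsto_ident_at)
          (auto intro: eventually_mono[OF eventually_at_right_less])
      then have "\<forall>\<^sub>F \<rho> in at_right ?d. \<rho> powr s < ?d powr s + e * (1 / 2) ^ Suc i"
        using e by (intro order_tendstoD) auto
      moreover have "\<forall>\<^sub>F \<rho> in at_right ?d. ?d < \<rho> \<and> \<rho> < 1 / r\<^sub>0"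
        using le_less_trans[OF U(3) \<delta>] by (auto simp: eventually_at_right_field)
      ultimately have "\<forall>\<^sub>F \<rho> in at_right ?d. ?d < \<rho> \<and> \<rho> \<le> 1 / r\<^sub>0 \<and> \<rho> powr s \<le> ?d powr s + e * (1 / 2) ^ Suc i"
        by eventually_elim auto
      from eventually_happens'[OF trivial_limit_at_right_real this] show ?thesis by blast
    qed
    then obtain \<rho> where \<rho>: "\<And>i. diameter (U i) < \<rho> i" "\<And>i. \<rho> i \<le> 1 / r\<^sub>0"
        "\<And>i. \<rho> i powr s \<le> diameter (U i) powr s + e * (1 / 2) ^ Suc i" by metis
    have \<rho>_pos: "0 < \<rho> i" for i
      using \<rho>(1)[of i] diameter_ge_0[OF U(2)[of i]] by simp
    \<comment> \<open>For an empty \<open>U i\<close> the centre is arbitrary; its ball costs no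
      more than the excess already allowed.\<close>
    define x where "x i = (SOME y. y \<in> U i)" for i
    have ball: "U i \<subseteq> ball (x i) (\<rho> i)" for i
    proof
      fix y assume y: "y \<in> U i"
      then have "x i \<in> U i" unfolding x_def by (rule someI)
      then show "y \<in> ball (x i) (\<rho> i)"
        using diameter_bounded_bound[OF U(2) \<open>x i \<in> U i\<close> y] \<rho>(1)[of i] by simp
    qed
    have "limit_set n \<subseteq> (\<Union>i. ball (x i) (\<rho> i))" using U(1) ball by blast
    then obtain I where I: "finite I" "limit_set n \<subseteq> (\<Union>i\<in>I. ball (x i) (\<rho> i))"
      using compactE_image[OF compact_limit_set[OF n], of UNIV "\<lambda>i. ball (x i) (\<rho> i)"] by auto
    have "(\<Sum>i. ennreal (e * (1 / 2) ^ Suc i)) = ennreal e"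
      using sums_mult[OF power_half_series, of e] e by (intro suminf_ennreal_eq) auto
    have "ennreal (A / B / mass_constant) \<le> ennreal (\<Sum>i\<in>I. \<rho> i powr s)"
      using n I \<rho>_pos \<rho>(2) by (intro ennreal_leI sum_radii_ge)
    also have "\<dots> = (\<Sum>i\<in>I. ennreal (\<rho> i powr s))" by simp
    also have "\<dots> \<le> (\<Sum>i\<in>I. diam_power s (U i) + ennreal (e * (1 / 2) ^ Suc i))"
    proof (rule sum_mono)
      fix i
      have "ennreal (\<rho> i powr s) \<le> ennreal (diameter (U i) powr s + e * (1 / 2) ^ Suc i)"
        using \<rho>(3) by (rule ennreal_leI)
      then show "ennreal (\<rho> i powr s) \<le> diam_power s (U i) + ennreal (e * (1 / 2) ^ Suc i)"
        using e s_pos by (simp add: diam_power_pos)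
    qed
    also have "\<dots> \<le> (\<Sum>i. diam_power s (U i) + ennreal (e * (1 / 2) ^ Suc i))"
      using I(1) by (intro sum_le_suminf) auto
    also have "\<dots> = (\<Sum>i. diam_power s (U i)) + (\<Sum>i. ennreal (e * (1 / 2) ^ Suc i))"
      by (rule suminf_add [symmetric]) auto
    also have "(\<Sum>i. ennreal (e * (1 / 2) ^ Suc i)) = ennreal e" by fact
    finally show "ennreal (A / B / mass_constant) \<le> (\<Sum>i. diam_power s (U i)) + ennreal e" .
  qed
qed

lemma hausdorff_measure_limit_set_ge:
  assumes "1 \<le> n"
  shows "ennreal (A / B / mass_constant) \<le> hausdorff_measure s (limit_set n)"
  using hausdorff_premeasure_limit_set_ge[OF assms, of "1 / (2 * r\<^sub>0)"]
    hausdorff_premeasure_le_measure[of "1 / (2 * r\<^sub>0)" s "limit_set n"] r\<^sub>0_pos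
  by (auto simp: field_simps)

lemma box_dim_limit_set:
  assumes n: "1 \<le> n"
  shows "lower_box_dim (limit_set n) = ereal s" "upper_box_dim (limit_set n) = ereal s"
proof -
  let ?b = "A / B / mass_constant" and ?c = "B * (diameter X / r\<^sub>0) powr s / H n"
  have pos: "0 < ?b" "0 < ?c"
    using A_pos B_pos mass_constant_pos H_pos[OF n] diam_pos r\<^sub>0_pos by auto
  have "0 < min (1 / r\<^sub>0) (diameter X / r\<^sub>0)" using r\<^sub>0_pos diam_pos by simp
  then have small: "\<forall>\<^sub>F \<delta> in at_right 0. 0 < \<delta> \<and> \<delta> < min (1 / r\<^sub>0) (diameter X / r\<^sub>0)"
    unfolding eventually_at_right_field by blast
  have lower: "\<forall>\<^sub>F \<delta> in at_right 0. ?b * \<delta> powr - s \<le> real (covering_number \<delta> (limit_set n))"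
    using small
  proof eventually_elim
    case (elim \<delta>)
    then have \<delta>: "0 < \<delta>" "\<delta> \<le> diameter X / r\<^sub>0" "\<delta> < 1 / r\<^sub>0" by simp_all
    obtain C where C: "finite C" "limit_set n \<subseteq> \<Union>C" "\<forall>U\<in>C. bounded U \<and> diameter U \<le> \<delta>"
      using limit_set_cover[OF n \<delta>(1,2)] by blast
    show ?case
      using C by (intro covering_number_ge s_pos \<delta>(1) hausdorff_premeasure_limit_set_ge n \<delta>(3)) auto
  qed
  have upper: "\<forall>\<^sub>F \<delta> in at_right 0. real (covering_number \<delta> (limit_set n)) \<le> ?c * \<delta> powr - s"
    using small
  proof eventually_elim
    case (elim \<delta>)
    then have \<delta>: "0 < \<delta>" "\<delta> \<le> diameter X / r\<^sub>0" by simp_all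
    show ?case using n \<delta> by (rule covering_number_limit_set_le)
  qed
  show "lower_box_dim (limit_set n) = ereal s" "upper_box_dim (limit_set n) = ereal s"
    by (rule box_dim_eqI[OF pos lower upper])+
qed

lemma hausdorff_dim_limit_set:
  assumes "1 \<le> n"
  shows "hausdorff_dim (limit_set n) = ereal s"
proof (rule hausdorff_dim_eqI)
  have "0 < ennreal (A / B / mass_constant)"
    using A_pos B_pos mass_constant_pos by simp
  then show "0 < hausdorff_measure s (limit_set n)"
    using hausdorff_measure_limit_set_ge[OF assms] by (rule less_le_trans)
  show "hausdorff_measure s (limit_set n) < \<infinity>"
    using hausdorff_measure_limit_set_le[OF assms] by (rule le_less_trans) simp
qed (use s_pos in simp)

end

section \<open>The uniform Moran condition\<close>

text \<open>The lower limit controls a tail only; the finitely many earlier terms are positive, so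
  their minimum with the tail bound is still positive.\<close>

lemma liminf_pos_imp_bounded_below:
  fixes f :: "nat \<Rightarrow> real"
  assumes "\<And>n. 0 < f n" "0 < liminf (\<lambda>n. ereal (f n))"
  obtains A where "0 < A" "\<And>n. A \<le> f n"
proof -
  obtain a where a: "0 < ereal a" "ereal a < liminf (\<lambda>n. ereal (f n))"
    using ereal_dense2[OF assms(2)] by blast
  then have "\<forall>\<^sub>F n in sequentially. ereal a < ereal (f n)" by (intro less_LiminfD)
  then obtain k where k: "\<And>n. k \<le> n \<Longrightarrow> a < f n"
    by (auto simp: eventually_sequentially)
  show thesis
  proof (rule that)
    show "0 < Min (insert a (f ` {..<k}))" using a(1) assms(1) by (subst Min_gr_iff) auto
    show "Min (insert a (f ` {..<k})) \<le> f n" for n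
    proof (cases "n < k")
      case False
      then have "a \<le> f n" using k[of n] by simp
      moreover have "Min (insert a (f ` {..<k})) \<le> a" by (rule Min_le) auto
      ultimately show ?thesis by linarith
    qed (auto intro: Min_le)
  qed
qed

lemma limsup_less_infinity_imp_bounded_above:
  fixes f :: "nat \<Rightarrow> real"
  assumes "limsup (\<lambda>n. ereal (f n)) < \<infinity>"
  obtains B where "\<And>n. f n \<le> B"
proof -
  obtain b where b: "limsup (\<lambda>n. ereal (f n)) < ereal b"
    using ereal_dense2[OF assms] by blast
  then have "\<forall>\<^sub>F n in sequentially. ereal (f n) < ereal b" by (rule Limsup_lessD)
  then obtain k where k: "\<And>n. k \<le> n \<Longrightarrow> f n < b"
    by (auto simp: eventually_sequentially)
  show thesis
  proof (rule that)
    show "f n \<le> Max (insert b (f ` {..<k}))" for n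
    proof (cases "n < k")
      case False
      then have "f n \<le> b" using k[of n] by simp
      moreover have "b \<le> Max (insert b (f ` {..<k}))" by (rule Max_ge) auto
      ultimately show ?thesis by linarith
    qed (auto intro: Max_ge)
  qed
qed

text \<open>Up to a shift of the index, the product is the full one divided by a fixed positive
  initial factor.\<close>

lemma prod_shift_tendsto_0:
  fixes c :: "nat \<Rightarrow> real"
  assumes "\<And>i. 1 \<le> i \<Longrightarrow> 0 < c i" "(\<lambda>n. \<Prod>j=1..n. c j) \<longlonglongrightarrow> 0" "1 \<le> n"
  shows "(\<lambda>m. \<Prod>i<m. c (n + i)) \<longlonglongrightarrow> 0"
proof -
  let ?p = "\<Prod>j=1..<n. c j"
  have p: "0 < ?p" using assms(1) by (intro prod_pos) auto
  have eq: "(\<Prod>j=1..m + (n - 1). c j) = ?p * (\<Prod>i<m. c (n + i))" for m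
  proof (induction m)
    case 0
    have "{1..n - 1} = {1..<n}" using assms(3) by auto
    then show ?case by simp
  next
    case (Suc m)
    have "(\<Prod>j=1..Suc m + (n - 1). c j) = (\<Prod>j=1..m + (n - 1). c j) * c (Suc m + (n - 1))"
      by simp
    then show ?case using Suc.IH assms(3) by (simp add: mult_ac add.commute)
  qed
  have "(\<lambda>m. (\<Prod>j=1..m + (n - 1). c j) / ?p) \<longlonglongrightarrow> 0 / ?p"
    by (intro tendsto_divide tendsto_const LIMSEQ_ignore_initial_segment assms(2) less_imp_neq[OF p, THEN not_sym])
  then show ?thesis unfolding eq using less_imp_neq[OF p, THEN not_sym] by simp
qed

section \<open>The given maps as surjective similarities, and the theorem\<close>

lemma dist_mifs_map:
  assumes "orthogonal_matrix (Q n j)" "0 < r n j"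
  shows "dist (mifs_map r Q \<alpha> n j x) (mifs_map r Q \<alpha> n j y) = r n j * dist x y"
proof -
  have "orthogonal_transformation ((*v) (Q n j))"
    using assms(1) by (simp add: orthogonal_transformation_matrix)
  then have norm_eq: "norm (Q n j *v z) = norm z" for z by (rule orthogonal_transformation_norm)
  have "mifs_map r Q \<alpha> n j x - mifs_map r Q \<alpha> n j y = r n j *\<^sub>R (Q n j *v (x - y))"
    by (simp add: mifs_map_def flip: scaleR_diff_right matrix_vector_mult_diff_distrib)
  then show ?thesis using assms(2) by (simp add: dist_norm norm_eq)
qed

lemma surj_mifs_map:
  assumes "orthogonal_matrix (Q n j)" "0 < r n j"
  shows "surj (mifs_map r Q \<alpha> n j)"
proof (rule surjI)
  fix x
  show "mifs_map r Q \<alpha> n j (transpose (Q n j) *v ((1 / r n j) *\<^sub>R x) - \<alpha> n j) = x"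
    using assms by (simp add: mifs_map_def matrix_vector_mul_assoc orthogonal_matrix_def
        del: transpose_matrix_vector)
qed

theorem theorem4p4:
  fixes X :: "(real^'d) set"
    and N :: "nat \<Rightarrow> nat"
    and r :: "nat \<Rightarrow> nat \<Rightarrow> real"
    and Q :: "nat \<Rightarrow> nat \<Rightarrow> real^'d^'d"
    and \<alpha> :: "nat \<Rightarrow> nat \<Rightarrow> real^'d"
    and a :: "real^'d"
    and s :: real
  defines "\<phi> \<equiv> mifs_map r Q \<alpha>"
  defines "K \<equiv> mifs_attractor N \<phi> a"
  assumes "self_similar_mifs X N r Q \<alpha>"
    and "a \<in> X"
    and "moran_open_set_condition X N \<phi>"
    and "0 \<le> s"
    and "0 < liminf (\<lambda>n. ereal (\<Prod>i=1..n. \<Sum>j=1..N i. r i j powr s))"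
    and "liminf (\<lambda>n. ereal (\<Prod>i=1..n. \<Sum>j=1..N i. r i j powr s))
           \<le> limsup (\<lambda>n. ereal (\<Prod>i=1..n. \<Sum>j=1..N i. r i j powr s))"
    and "limsup (\<lambda>n. ereal (\<Prod>i=1..n. \<Sum>j=1..N i. r i j powr s)) < \<infinity>"
    and "0 < (INF (n, j) \<in> {(n, j). 1 \<le> n \<and> 1 \<le> j \<and> j \<le> N n}. r n j)"
  shows "(\<infinity> > (SUP k\<in>{1..}. hausdorff_measure s (K k)) \<and>
          (SUP k\<in>{1..}. hausdorff_measure s (K k)) \<ge> (INF k\<in>{1..}. hausdorff_measure s (K k)) \<and>
          (INF k\<in>{1..}. hausdorff_measure s (K k)) > 0) \<and>
         (\<forall>n\<ge>1. hausdorff_dim (K n) = ereal s \<and>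
                lower_box_dim (K n) = ereal s \<and>
                upper_box_dim (K n) = ereal s)"
proof -
  let ?p = "\<lambda>n. \<Prod>i=1..n. \<Sum>j=1..N i. r i j powr s"
  note mifs = assms(3)[unfolded self_similar_mifs_def, folded \<phi>_def]
  have compact: "compact X" and nonempty: "X \<noteq> {}" and two_le_N: "\<And>n. 1 \<le> n \<Longrightarrow> 2 \<le> N n"
    using mifs by auto
  have maps: "0 < r n j" "orthogonal_matrix (Q n j)" "\<phi> n j ` X \<subseteq> X" if "1 \<le> n" "j \<in> {1..N n}" for n j
    using mifs that by blast+
  obtain c1 c2 :: "nat \<Rightarrow> real" where c_all: "\<forall>n\<ge>1. 0 < c1 n \<and> c1 n \<le> c2 n \<and> c2 n < 1 \<and>
      (\<forall>j\<in>{1..N n}. c1 n \<le> r n j \<and> r n j \<le> c2 n)" and c_lim: "(\<lambda>n. \<Prod>j=1..n. c2 j) \<longlonglongrightarrow> 0"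
    using mifs by blast
  have c_pos: "0 < c2 n" if "1 \<le> n" for n using c_all that by (meson less_le_trans)
  have r_le: "r n j \<le> c2 n" if "1 \<le> n" "j \<in> {1..N n}" for n j using c_all that by blast
  interpret similarity_system X N r \<phi> c2
  proof
    show "1 \<le> N n" if "1 \<le> n" for n using two_le_N[OF that] by simp
    show "dist (\<phi> n j x) (\<phi> n j y) = r n j * dist x y" if "1 \<le> n" "j \<in> {1..N n}" for n j x y
      unfolding \<phi>_def using maps(2,1)[OF that] by (rule dist_mifs_map)
    show "(\<lambda>m. \<Prod>i<m. c2 (n + i)) \<longlonglongrightarrow> 0" if "1 \<le> n" for n
      using c_pos c_lim that by (rule prod_shift_tendsto_0)
  qed (use compact nonempty maps r_le in auto)

  have level_sum_pos: "0 < (\<Sum>j=1..N i. r i j powr s)" if "1 \<le> i" for i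
  proof (rule sum_pos)
    fix j assume "j \<in> {1..N i}"
    then have "0 < r i j" by (rule maps(1)[OF that])
    then show "0 < r i j powr s" by simp
  qed (use two_le_N[OF that] in auto)
  have p_pos: "0 < ?p n" for n
    using level_sum_pos by (intro prod_pos) auto
  obtain A where A: "0 < A" "\<And>n. A \<le> ?p n"
    using liminf_pos_imp_bounded_below[OF p_pos assms(7)] by blast
  obtain B where B: "\<And>n. ?p n \<le> B"
    using limsup_less_infinity_imp_bounded_above[OF assms(9)] by blast
  \<comment> \<open>The products of the theorem include level n, whereas \<open>moran_prod\<close>
    stops just before it.\<close>
  have moran_prod_eq: "moran_prod N r s n = ?p (n - 1)" if "1 \<le> n" for n
  proof -
    have "{1..<n} = {1..n - 1}" using that by auto
    then show ?thesis by (simp add: moran_prod_def)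
  qed
  \<comment> \<open>For s = 0 each level sum is the number of maps, at least 2, so the products
    would grow like powers of 2 and exceed B.\<close>
  have "s \<noteq> 0"
  proof
    assume "s = 0"
    have "2 \<le> (\<Sum>j=1..N i. r i j powr s)" if "1 \<le> i" for i
    proof -
      have "(\<Sum>j=1..N i. r i j powr s) = (\<Sum>j=1..N i. 1)"
      proof (rule sum.cong)
        fix j assume "j \<in> {1..N i}"
        then have "0 < r i j" by (rule maps(1)[OF that])
        then show "r i j powr s = 1" by (simp add: \<open>s = 0\<close>)
      qed simp
      then show ?thesis using two_le_N[OF that] by simp
    qed
    then have "(\<Prod>i=1..n. 2) \<le> ?p n" for n
      by (intro prod_mono) auto
    then have "2 ^ n \<le> B" for n
      using B[of n] by (auto intro: order_trans)
    moreover obtain n where "B < 2 ^ n" using real_arch_pow[of 2 B] by auto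
    ultimately show False by (meson not_less)
  qed
  then have s_pos: "0 < s" using assms(6) by simp

  obtain V where V: "\<forall>n\<ge>1. open (V n) \<and> V n \<subseteq> X"
      "\<forall>n\<ge>1. \<forall>j\<in>{1..N n}. \<phi> n j ` V (Suc n) \<subseteq> V n"
      "\<forall>n\<ge>1. \<forall>i\<in>{1..N n}. \<forall>j\<in>{1..N n}. i \<noteq> j \<longrightarrow> \<phi> n i ` V (Suc n) \<inter> \<phi> n j ` V (Suc n) = {}"
      and V_inf: "0 < (INF n\<in>{1..}. emeasure lebesgue (V n))"
    using assms(5) unfolding moran_open_set_condition_def by (elim exE conjE) (rule that)
  have V_measurable: "V n \<in> lmeasurable" if "1 \<le> n" for n
    using V(1) that compact_imp_bounded[OF compact] by (intro lmeasurable_open) (auto intro: bounded_subset)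
  \<comment> \<open>A number strictly below the infimum is automatically finite and so comes from a
    real v.\<close>
  obtain y where y: "0 < y" "y < (INF n\<in>{1..}. emeasure lebesgue (V n))"
    using dense[OF V_inf] by blast
  then obtain v where v: "0 \<le> v" "y = ennreal v" by (cases y) auto
  have v_pos: "0 < v" using y(1) v by (simp add: ennreal_less_zero_iff)
  have v_le: "v \<le> measure lebesgue (V n)" if "1 \<le> n" for n
  proof -
    have "ennreal v \<le> emeasure lebesgue (V n)"
      using y(2) that unfolding v(2) by (meson INF_lower atLeast_iff less_imp_le order_trans)
    then show ?thesis using V_measurable[OF that] by (simp add: emeasure_eq_measure2)
  qed
  \<comment> \<open>Positive volume puts a ball inside X, which excludes a one-point X and makes its
    diameter positive.\<close>
  have "V 1 \<noteq> {}" using v_le[of 1] v_pos by auto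
  then obtain x e where x: "0 < e" "ball x e \<subseteq> V 1"
    using V(1) by (metis all_not_in_conv open_contains_ball order_refl)
  have "diameter (ball x e) \<le> diameter X"
    using x V(1) compact_imp_bounded[OF compact] by (intro diameter_subset) auto
  then have diam_pos: "0 < diameter X" using x(1) by simp

  let ?I = "{(n, j). 1 \<le> n \<and> 1 \<le> j \<and> j \<le> N n}"
  define r0 where "r0 = (INF (n, j)\<in>?I. r n j)"
  have r0_le: "r0 \<le> r n j" if "1 \<le> n" "j \<in> {1..N n}" for n j
  proof -
    \<comment> \<open>A real infimum is a lower bound only if the set is bounded below; here 0
      bounds the ratios.\<close>
    have "bdd_below ((\<lambda>(n, j). r n j) ` ?I)"
      using maps(1) by (intro bdd_belowI[of _ 0]) (auto intro: less_imp_le)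
    then have "r0 \<le> (\<lambda>(n, j). r n j) (n, j)"
      unfolding r0_def by (rule cINF_lower) (use that in auto)
    then show ?thesis by simp
  qed

  interpret moran_open_set_system X N r \<phi> c2 s A B r0 V v
  proof
    show "surj (\<phi> n j)" if "1 \<le> n" "j \<in> {1..N n}" for n j
      unfolding \<phi>_def using maps(2,1)[OF that] by (rule surj_mifs_map)
    show "0 < r0" unfolding r0_def by (rule assms(10))
    show "A \<le> moran_prod N r s n" "moran_prod N r s n \<le> B" if "1 \<le> n" for n
      using A(2) B by (simp_all add: moran_prod_eq[OF that])
  qed (use s_pos A(1) r0_le diam_pos V v_pos v_le in auto)

  have K_eq: "K n = limit_set n" if "1 \<le> n" for n
    unfolding K_def using that assms(4) by (rule mifs_attractor_eq_limit_set)
  let ?l = "ennreal (A / B / mass_constant)" and ?u = "ennreal (B / A * diameter X powr s)"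
  have upper: "hausdorff_measure s (K n) \<le> ?u" if "1 \<le> n" for n
    unfolding K_eq[OF that] using that by (rule hausdorff_measure_limit_set_le)
  have lower: "?l \<le> hausdorff_measure s (K n)" if "1 \<le> n" for n
    unfolding K_eq[OF that] using that by (rule hausdorff_measure_limit_set_ge)
  have "(SUP k\<in>{1..}. hausdorff_measure s (K k)) \<le> ?u"
    using upper by (intro SUP_least) simp
  then have "(SUP k\<in>{1..}. hausdorff_measure s (K k)) < \<infinity>"
    by (rule le_less_trans) simp
  moreover have "(INF k\<in>{1..}. hausdorff_measure s (K k)) \<le> (SUP k\<in>{1..}. hausdorff_measure s (K k))"
    by (rule INF_le_SUP) simp
  moreover have "0 < (INF k\<in>{1..}. hausdorff_measure s (K k))"
  proof (rule less_le_trans)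
    show "0 < ?l" using A_pos B_pos mass_constant_pos by simp
    show "?l \<le> (INF k\<in>{1..}. hausdorff_measure s (K k))"
      using lower by (intro INF_greatest) simp
  qed
  moreover have "hausdorff_dim (K n) = ereal s \<and> lower_box_dim (K n) = ereal s \<and> upper_box_dim (K n) = ereal s"
    if "1 \<le> n" for n
    using hausdorff_dim_limit_set[OF that] box_dim_limit_set[OF that] by (simp add: K_eq[OF that])
  ultimately show ?thesis by blast
qed

end
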